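(* The Thurston-Bennequin invariant and the rotation number of a fence diagram of a quasipositive annulus are invariant under inflations, deflations, slips, slides, twirls and turns. (The rotation number is computed with respect to an orientation of the reduced, cusped fence diagram that is carried along by the moves; reversing the orientation changes its sign.)
   Context: **Fence diagrams.** A fence diagram consists of $b\ge 1$ horizontal segments in the $yz$-plane, numbered $1,\dots,b$ from top to bottom, and a finite left-to-right sequence of vertical segments, each joining two horizontal segments $i<j$ and passing over those in between. A vertical segment joining lines $i<j$ is denoted $(i,j)$. The diagram represents a quasipositive diagram of a quasipositive surface: $b$ parallel disks with one positively half-twisted band for each $(i,j)$, corresponding to the braid $\sigma_{i,j}=(\sigma_i\cdots\sigma_{j-2})\sigma_{j-1}(\sigma_i\cdots\sigma_{j-2})^{-1}$. A fence diagram of a quasipositive annulus is one whose surface is an annulus. **Moves of fence diagrams.** - Inflation: insert a new horizontal line (at any height) together with one new vertical segment (at any position) joining it to an existing horizontal line. Deflation: the inverse. - Slip: exchange two consecutive vertical segments $(i,j)$, $(k,l)$ whose four endpoints lie on distinct lines and whose intervals $[i,j]$, $[k,l]$ are disjoint or nested. - Slide: for $i<j<k$, replace consecutive vertical segments (read left to right) according to $(i,j)(j,k)\leftrightarrow(i,k)(i,j)$ or $(i,j)(j,k)\leftrightarrow(j,k)(i,k)$. - Twirl: move the top horizontal line to the bottom, keeping the left-to-right order of the vertical segments and which lines they join (so $(1,j)$ becomes $(j-1,b)$ and $(i,j)$ with $i\ge2$ becomes $(i-1,j-1)$), or the inverse. - Turn: move the leftmost vertical segment to the far right, or the inverse. **Reduced,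 cusped fence diagrams.** The cusped fence diagram is obtained by making each vertical segment a very steep curve of negative slope and bending it near its endpoints so that the top end leaves the upper horizontal line tangentially towards the right and the bottom end arrives tangentially from the left at the lower horizontal line. The reduced, cusped fence diagram is obtained by applying deflations as often as possible and then retracting the left and right ends of every horizontal line until they reach an endpoint of a vertical segment. For an annulus it is a closed curve whose cusps are the left-top and right-bottom corners; it is the front projection (to the $yz$-plane) of a Legendrian knot in $(\mathbb{R}^3,\ker(dz+x\,dy))$, with the arc of smaller slope passing over at each crossing. **Invariants.** For a Legendrian knot $\gamma$ with generic front $w$, oriented, $tb(\gamma)=p(w)-n(w)-r_c(w)$, where $p(w)$, $n(w)$ are the numbers of positive and negative crossings and $r_c(w)$ the number of right cusps; the rotation number is $r(\vec\gamma)=\frac12(d_c(w)-u_c(w))$, where $d_c(w)$, $u_c(w)$ are the numbers of downward and upward cusps. The Thurston-Bennequin invariant and the rotation number of a fence diagram of a quasipositive annulus are those of its reduced, cusped fence diagram. *)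

theory Defs
  imports "HOL-Analysis.Analysis"
begin

subsection \<open>Fence diagrams and their surfaces\<close>

text \<open>
  A fence diagram is the number \<open>b\<close> of its horizontal lines (numbered \<open>1, ..., b\<close> from top to
  bottom) together with the left-to-right list of its vertical segments; a segment joining the
  lines \<open>i < j\<close> is the pair \<open>(i, j)\<close>. Segments are identified by their (0-based) list position.
\<close>

type_synonym fence = "nat \<times> (nat \<times> nat) list"

definition is_fence :: "fence \<Rightarrow> bool" where
  "is_fence F \<longleftrightarrow> 1 \<le> fst F \<and> (\<forall>(i, j) \<in> set (snd F). 1 \<le> i \<and> i < j \<and> j \<le> fst F)"

text \<open>
  The surface is realised in 3-space with coordinates \<open>(x, y, z)\<close>. The disks are parallel
  horizontal rectangles at the heights \<open>z = -1, ..., -b\<close>, whose front edges (in \<open>x = 0\<close>) project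
  to the horizontal lines. The band of the segment at position \<open>m\<close> starts and ends on front edges,
  at \<open>\<bar>y - m\<bar> \<le> 1/4\<close>, and runs through \<open>x > 0\<close>, hence in front of the disks in between. It makes
  a half twist, because the direction \<open>t \<mapsto> (- sin (pi * s), cos (pi * s), 0)\<close> across the band turns
  by \<open>pi\<close>; seen from the front (\<open>x = +\<infinity>\<close>, \<open>y\<close> to the right, \<open>z\<close> upwards) the band edge \<open>t = -1/4\<close>
  running from upper left to lower right crosses over the other edge, so that this is the
  positive half twist.
\<close>

definition fence_disk :: "nat \<Rightarrow> nat \<Rightarrow> (real \<times> real \<times> real) set" where
  "fence_disk n i = {(x, y, z). -1 \<le> x \<and> x \<le> 0 \<and> -1 \<le> y \<and> y \<le> real n \<and> z = - real i}"

definition fence_band :: "nat \<Rightarrow> nat \<times> nat \<Rightarrow> (real \<times> real \<times> real) set" where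
  "fence_band m = (\<lambda>(i, j).
     {(sin (pi * s) * (1 - t), real m + t * cos (pi * s), - real i - (real j - real i) * s) | s t.
        0 \<le> s \<and> s \<le> 1 \<and> \<bar>t\<bar> \<le> 1 / 4})"

definition fence_surface :: "fence \<Rightarrow> (real \<times> real \<times> real) set" where
  "fence_surface F =
     (\<Union>i \<in> {1..fst F}. fence_disk (length (snd F)) i) \<union>
     (\<Union>m \<in> {..<length (snd F)}. fence_band m (snd F ! m))"

definition annulus_fence :: "fence \<Rightarrow> bool" where
  "annulus_fence F \<longleftrightarrow> is_fence F \<and>
     fence_surface F homeomorphic {w::complex. 1 \<le> norm w \<and> norm w \<le> 2}"


subsection \<open>Fence diagrams carrying an orientation of their reduced, cusped diagram\<close>

text \<open>
  To carry an orientation of the closed curve along the moves, each vertical segment gets a label: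
  \<open>1\<close> if the oriented curve runs down the segment, \<open>-1\<close> if it runs up, and \<open>0\<close> if the segment does
  not belong to the reduced diagram.
\<close>

type_synonym labelled_fence = "nat \<times> (nat \<times> nat \<times> int) list"

definition underlying :: "labelled_fence \<Rightarrow> fence" where
  "underlying D = (fst D, map (\<lambda>(i, j, e). (i, j)) (snd D))"

definition reverse :: "labelled_fence \<Rightarrow> labelled_fence" where
  "reverse D = (fst D, map (\<lambda>(i, j, e). (i, j, - e)) (snd D))"


subsection \<open>Moves\<close>

text \<open>The new number of an old line \<open>k\<close> after insertion of a line that gets the number \<open>p\<close>.\<close>

definition lift_line :: "nat \<Rightarrow> nat \<Rightarrow> nat" where
  "lift_line p k = (if k < p then k else k + 1)"

definition lift_seg :: "nat \<Rightarrow> nat \<times> nat \<times> int \<Rightarrow> nat \<times> nat \<times> int" where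
  "lift_seg p = (\<lambda>(i, j, e). (lift_line p i, lift_line p j, e))"

inductive inflation :: "labelled_fence \<Rightarrow> labelled_fence \<Rightarrow> bool" where
  "\<lbrakk>1 \<le> p; p \<le> b + 1; 1 \<le> q; q \<le> b\<rbrakk> \<Longrightarrow>
   inflation (b, us @ ws)
     (b + 1, map (lift_seg p) us @
             [(min p (lift_line p q), max p (lift_line p q), 0)] @
             map (lift_seg p) ws)"

definition deflation :: "labelled_fence \<Rightarrow> labelled_fence \<Rightarrow> bool" where
  "deflation D D' \<longleftrightarrow> inflation D' D"

inductive slip :: "labelled_fence \<Rightarrow> labelled_fence \<Rightarrow> bool" where
  "\<lbrakk>distinct [i, j, k, l];
    {i..j} \<inter> {k..l} = {} \<or> {i..j} \<subseteq> {k..l} \<or> {k..l} \<subseteq> {i..j}\<rbrakk> \<Longrightarrow>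
   slip (b, us @ [(i, j, e), (k, l, f)] @ ws) (b, us @ [(k, l, f), (i, j, e)] @ ws)"

text \<open>
  In a slide one segment stays and the other one is slid along it. The part of the curve on the
  slid segment is carried along: in the first rule, a passage down \<open>(j, k)\<close> becomes a passage
  from \<open>j\<close> up \<open>(i, j)\<close> and then down \<open>(i, k)\<close>, opposite passages along \<open>(i, j)\<close> cancelling;
  similarly, in the second rule a passage down \<open>(i, j)\<close> becomes a passage down \<open>(i, k)\<close> and then
  up \<open>(j, k)\<close>.
\<close>

inductive slide :: "labelled_fence \<Rightarrow> labelled_fence \<Rightarrow> bool" where
  "\<lbrakk>i < j; j < k\<rbrakk> \<Longrightarrow>
   slide (b, us @ [(i, j, e), (j, k, f)] @ ws) (b, us @ [(i, k, f), (i, j, e - f)] @ ws)"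
| "\<lbrakk>i < j; j < k\<rbrakk> \<Longrightarrow>
   slide (b, us @ [(i, j, e), (j, k, f)] @ ws) (b, us @ [(j, k, f - e), (i, k, e)] @ ws)"

text \<open>
  The label of a segment at the top line changes sign in a twirl, since its upper end becomes its
  lower end.
\<close>

definition twirl_seg :: "nat \<Rightarrow> nat \<times> nat \<times> int \<Rightarrow> nat \<times> nat \<times> int" where
  "twirl_seg b = (\<lambda>(i, j, e). if i = 1 then (j - 1, b, - e) else (i - 1, j - 1, e))"

inductive twirl :: "labelled_fence \<Rightarrow> labelled_fence \<Rightarrow> bool" where
  "twirl (b, vs) (b, map (twirl_seg b) vs)"

inductive turn :: "labelled_fence \<Rightarrow> labelled_fence \<Rightarrow> bool" where
  "turn (b, v # vs) (b, vs @ [v])"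

definition basic_move :: "labelled_fence \<Rightarrow> labelled_fence \<Rightarrow> bool" where
  "basic_move D D' \<longleftrightarrow>
     inflation D D' \<or> slip D D' \<or> slide D D' \<or> twirl D D' \<or> turn D D'"

text \<open>An inflation, deflation, slip, slide, twirl or turn, where slides, twirls and turns may be
  performed in either direction; the labels are carried along.\<close>

definition labelled_move :: "labelled_fence \<Rightarrow> labelled_fence \<Rightarrow> bool" where
  "labelled_move D D' \<longleftrightarrow> is_fence (underlying D) \<and> is_fence (underlying D') \<and>
     (basic_move D D' \<or> basic_move D' D)"

text \<open>The moves of unlabelled diagrams are obtained by forgetting the labels; the rules above apply
  whatever the labels on the left-hand sides are.\<close>

definition fence_move :: "fence \<Rightarrow> fence \<Rightarrow> bool" where
  "fence_move F F' \<longleftrightarrow>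
     (\<exists>D D'. underlying D = F \<and> underlying D' = F' \<and> labelled_move D D')"


subsection \<open>Reduced, cusped fence diagrams\<close>

text \<open>
  Deflations are applied as often as possible. For a connected diagram with at least one cycle (in
  particular for a diagram of an annulus) the result does not depend on their order. Note that
  deflations only remove segments labelled \<open>0\<close>; a nonzero label on another segment that should be
  removed violates the balance condition in \<open>oriented\<close>.
\<close>

definition reduced :: "labelled_fence \<Rightarrow> labelled_fence" where
  "reduced D = (SOME R. deflation\<^sup>*\<^sup>* D R \<and> (\<nexists>R'. deflation R R'))"

text \<open>
  A labelling is an orientation of the reduced, cusped diagram if each of its segments is
  oriented and if at each horizontal line the curve arrives at one end and leaves at the other.
\<close>

definition oriented :: "labelled_fence \<Rightarrow> bool" where
  "oriented D \<longleftrightarrow>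
     (case reduced D of (b, vs) \<Rightarrow>
        (\<forall>(i, j, e) \<in> set vs. e = 1 \<or> e = -1) \<and>
        (\<forall>k \<in> {1..b}.
           (\<Sum>(i, j, e) \<leftarrow> vs. if j = k then e else if i = k then - e else 0) = 0))"

text \<open>
  In the following, \<open>vs\<close> is the list of labelled segments of a reduced diagram. Retracting its
  ends, line \<open>k\<close> becomes the interval from position \<open>left_end vs k\<close> to position \<open>right_end vs k\<close>.
\<close>

definition upper :: "(nat \<times> nat \<times> int) list \<Rightarrow> nat \<Rightarrow> nat" where
  "upper vs m = fst (vs ! m)"

definition lower :: "(nat \<times> nat \<times> int) list \<Rightarrow> nat \<Rightarrow> nat" where
  "lower vs m = fst (snd (vs ! m))"

definition sdir :: "(nat \<times> nat \<times> int) list \<Rightarrow> nat \<Rightarrow> int" where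
  "sdir vs m = snd (snd (vs ! m))"

definition endpoints :: "(nat \<times> nat \<times> int) list \<Rightarrow> nat \<Rightarrow> nat set" where
  "endpoints vs k = {m. m < length vs \<and> (upper vs m = k \<or> lower vs m = k)}"

definition left_end :: "(nat \<times> nat \<times> int) list \<Rightarrow> nat \<Rightarrow> nat" where
  "left_end vs k = Min (endpoints vs k)"

definition right_end :: "(nat \<times> nat \<times> int) list \<Rightarrow> nat \<Rightarrow> nat" where
  "right_end vs k = Max (endpoints vs k)"

text \<open>
  The direction of the curve on line \<open>k\<close>: \<open>1\<close> if it runs to the right, that is, if it enters the
  line at the left end.
\<close>

definition hdir :: "(nat \<times> nat \<times> int) list \<Rightarrow> nat \<Rightarrow> int" where
  "hdir vs k = (let m = left_end vs k in if lower vs m = k then sdir vs m else - sdir vs m)"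

definition crossings :: "(nat \<times> nat \<times> int) list \<Rightarrow> (nat \<times> nat) set" where
  "crossings vs = {(m, k). m < length vs \<and> upper vs m < k \<and> k < lower vs m \<and>
                           left_end vs k < m \<and> m < right_end vs k}"

text \<open>
  At a crossing the steep arc of negative slope passes over. If it runs down and the horizontal
  arc runs to the right, then the horizontal arc points to the left-hand side of the overcrossing
  arc, and so the crossing is positive; reversing one of the arcs changes the sign.
\<close>

definition crossing_sign :: "(nat \<times> nat \<times> int) list \<Rightarrow> nat \<times> nat \<Rightarrow> int" where
  "crossing_sign vs = (\<lambda>(m, k). sdir vs m * hdir vs k)"

text \<open>
  The top end of a segment leaves its upper line tangentially towards the right, and the bottom
  end arrives at its lower line tangentially from the left. Hence there is a left cusp at each
  left-top corner, a right cusp at each right-bottom corner, and the curve is smooth at the other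
  corners. A left (right) cusp is identified with its segment.
\<close>

definition left_cusps :: "(nat \<times> nat \<times> int) list \<Rightarrow> nat set" where
  "left_cusps vs = {m. m < length vs \<and> m = left_end vs (upper vs m)}"

definition right_cusps :: "(nat \<times> nat \<times> int) list \<Rightarrow> nat set" where
  "right_cusps vs = {m. m < length vs \<and> m = right_end vs (lower vs m)}"

definition front_tb :: "(nat \<times> nat \<times> int) list \<Rightarrow> int" where
  "front_tb vs =
     int (card {c \<in> crossings vs. crossing_sign vs c = 1})
     - int (card {c \<in> crossings vs. crossing_sign vs c = -1})
     - int (card (right_cusps vs))"

text \<open>
  At a left-top corner the segment is the lower branch of the cusp, and at a right-bottom corner it
  is the upper branch. In both cases the cusp is passed downwards iff the segment is.
\<close>

definition down_cusps :: "(nat \<times> nat \<times> int) list \<Rightarrow> nat" where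
  "down_cusps vs = card {m \<in> left_cusps vs. sdir vs m = 1} + card {m \<in> right_cusps vs. sdir vs m = 1}"

definition up_cusps :: "(nat \<times> nat \<times> int) list \<Rightarrow> nat" where
  "up_cusps vs = card {m \<in> left_cusps vs. sdir vs m = -1} + card {m \<in> right_cusps vs. sdir vs m = -1}"

definition front_rot :: "(nat \<times> nat \<times> int) list \<Rightarrow> rat" where
  "front_rot vs = (of_nat (down_cusps vs) - of_nat (up_cusps vs)) / 2"


subsection \<open>The invariants of a fence diagram\<close>

text \<open>The signs of the crossings do not depend on the orientation, so any one can be used.\<close>

definition fence_tb :: "fence \<Rightarrow> int" where
  "fence_tb F = front_tb (snd (reduced (SOME D. underlying D = F \<and> oriented D)))"

definition fence_rot :: "labelled_fence \<Rightarrow> rat" where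
  "fence_rot D = front_rot (snd (reduced D))"

end

theory Submission
  imports Defs
begin

text \<open>
  The disks and bands of the surface form a connected graph, and for an annulus this graph has at
  most one cycle: maps from the annulus to the circle that wind around two independent bands would be
  independent in the first cohomology, which has rank one. A labelling that orients the reduced
  diagram is the same as a primitive integral flow on the graph, and the moves carry flows to flows.

  Both invariants can be read off from the flow without reducing the diagram. The
  Thurston-Bennequin invariant is a quadratic form, the sum over pairs of segments of the number
  \<open>pairing\<close> below, which is essentially the Seifert form of the surface; hence it is invariant
  under each move by bilinearity and the balance of the flow. Twice the rotation number is the sum of
  all labels minus the sum of the directions in which the curve runs on the horizontal lines.
\<close>

subsection \<open>Fence diagrams of annuli\<close>

text \<open>Comparing the reduced diagrams before and after a move is awkward:
  \<open>reduced\<close> picks some end result of deflations, and a slide can change which segments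
  survive. Segments off the curve are labelled 0, so quantities read off the full labelled list skip
  them and reductions need not be followed through a move. The rotation is not linear in the labels,
  as the direction on a line is that of its first nonzero passage; its invariance also rests on
  \<open>cyclic\<close>, a property lifted from the reduced diagram. The topology supplies
  connectedness and the bound that there are at most as many segments as lines. Unlabelled diagrams
  add a layer: \<open>fence_tb\<close> picks some orientation and \<open>fence_move\<close> only
  provides some labels, so orientations must be unique up to sign and must follow every unlabelled
  move. Connectedness is phrased by cuts instead of paths: a set that no segment leaves contains all
  of V or none of it. Separations of the surface, permutations of lines and inserted lines then
  translate by direct substitution.\<close>

definition linked_by :: "(nat \<times> nat) set \<Rightarrow> nat set \<Rightarrow> bool" where
  "linked_by E V \<longleftrightarrow>
     (\<forall>X. (\<forall>(i, j) \<in> E. i \<in> X \<longleftrightarrow> j \<in> X) \<longrightarrow> V \<subseteq> X \<or> V \<inter> X = {})"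

lemma linked_byD:
  assumes "linked_by E V" "\<And>i j. (i, j) \<in> E \<Longrightarrow> i \<in> X \<longleftrightarrow> j \<in> X" "k \<in> V" "k \<in> X" "l \<in> V"
  shows "l \<in> X"
proof -
  have "V \<subseteq> X \<or> V \<inter> X = {}"
    using assms(1,2) unfolding linked_by_def by blast
  with assms(3-5) show ?thesis
    by blast
qed

lemma linked_by_mono: "linked_by E V \<Longrightarrow> E \<subseteq> E' \<Longrightarrow> linked_by E' V"
  unfolding linked_by_def by (meson subsetD)

section \<open>Logarithms and winding numbers on the annulus\<close>

lemma exp_eq_1_constant_on:
  fixes h :: "'a::topological_space \<Rightarrow> complex"
  assumes "connected S" "continuous_on S h" "\<And>x. x \<in> S \<Longrightarrow> exp (h x) = 1"
  shows "h constant_on S"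
proof (rule continuous_discrete_range_constant[OF assms(1,2)])
  fix x assume x: "x \<in> S"
  \<comment> \<open>The values of h lie in the integer multiples of 2 pi i; distinct ones are at
    least 2 pi apart, and the gap 1 is a convenient lower bound.\<close>
  have "1 \<le> norm (h y - h x)" if y: "y \<in> S" "h y \<noteq> h x" for y
  proof -
    obtain n where n: "Re (h x) = 0" "Im (h x) = of_int (2 * n) * pi"
      using assms(3)[OF x] exp_eq_1 by blast
    obtain m where m: "Re (h y) = 0" "Im (h y) = of_int (2 * m) * pi"
      using assms(3)[OF y(1)] exp_eq_1 by blast
    have "n \<noteq> m"
      using y(2) n m by (auto simp: complex_eq_iff)
    then have "1 \<le> \<bar>real_of_int (m - n)\<bar>"
      by linarith
    moreover have "1 \<le> 2 * pi"
      using pi_gt3 by simp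
    ultimately have "1 * 1 \<le> \<bar>real_of_int (m - n)\<bar> * (2 * pi)"
      by (intro mult_mono) auto
    then have "1 \<le> \<bar>real_of_int (m - n)\<bar> * (2 * pi)"
      by simp
    also have "\<dots> = \<bar>Im (h y - h x)\<bar>"
    proof -
      have "Im (h y - h x) = of_int (m - n) * (2 * pi)"
        unfolding minus_complex.simps n m of_int_diff of_int_mult by (simp add: left_diff_distrib)
      then show ?thesis
        by (simp only: abs_mult) simp
    qed
    also have "\<dots> \<le> norm (h y - h x)"
      by (rule abs_Im_le_cmod)
    finally show ?thesis .
  qed
  then show "\<exists>e>0. \<forall>y. y \<in> S \<and> h y \<noteq> h x \<longrightarrow> e \<le> norm (h y - h x)"
    using zero_less_one by blast
qed

text \<open>A fundamental domain of exp over the annulus with both horizontal sides kept. It is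
  compact and convex, at the price that exp glues its two sides.\<close>

definition log_strip :: "complex set" where
  "log_strip = cbox 0 (Complex (ln 2) (2 * pi))"

lemma log_strip_iff: "w \<in> log_strip \<longleftrightarrow> 0 \<le> Re w \<and> Re w \<le> ln 2 \<and> 0 \<le> Im w \<and> Im w \<le> 2 * pi"
  by (auto simp: log_strip_def in_cbox_complex_iff)

lemma exp_log_strip: "exp ` log_strip = {w::complex. 1 \<le> norm w \<and> norm w \<le> 2}"
proof (intro equalityI subsetI)
  fix z :: complex assume "z \<in> exp ` log_strip"
  then obtain w where w: "w \<in> log_strip" "z = exp w" by blast
  then have "exp 0 \<le> exp (Re w)" "exp (Re w) \<le> exp (ln 2 :: real)"
    unfolding log_strip_iff by (simp_all only: exp_le_cancel_iff)
  then show "z \<in> {w. 1 \<le> norm w \<and> norm w \<le> 2}"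
    using w by simp
next
  fix z :: complex assume z: "z \<in> {w. 1 \<le> norm w \<and> norm w \<le> 2}"
  define w where "w = Complex (ln (norm z)) (Arg2pi z)"
  have "z = exp w"
  proof -
    have "exp w = of_real (exp (ln (norm z))) * exp (\<i> * of_real (Arg2pi z))"
      by (simp only: w_def Complex_eq exp_add exp_of_real)
    also have "exp (ln (norm z)) = norm z"
      using z by (subst exp_ln) auto
    finally show ?thesis
      using Arg2pi_eq[of z] by metis
  qed
  moreover have "w \<in> log_strip"
    using z Arg2pi_ge_0[of z] Arg2pi_lt_2pi[of z]
    by (auto simp: w_def log_strip_iff intro!: ln_le_cancel_iff[THEN iffD2])
  ultimately show "z \<in> exp ` log_strip" by blast
qed

text \<open>The imaginary parts differ by a nonzero multiple of 2 pi but the strip has height 2 pi,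
  so the points lie opposite each other on its two sides; the last assumption says which one is at
  the bottom.\<close>

lemma exp_log_strip_eq:
  assumes "w \<in> log_strip" "w' \<in> log_strip" "exp w = exp w'" "w \<noteq> w'" "Im w \<le> Im w'"
  shows "w = of_real (Re w) \<and> w' = of_real (Re w) + 2 * of_real pi * \<i>"
proof -
  obtain n where n: "w' = w + (of_int (2 * n) * pi) * \<i>"
    using assms(3) exp_eq[of w' w] by auto
  have re: "Re w' = Re w" and im: "Im w' = Im w + 2 * pi * of_int n"
    using n by auto
  have "n \<noteq> 0"
    using n assms(4) by auto
  moreover have "0 \<le> n"
    using im assms(5) pi_gt_zero by (simp add: zero_le_mult_iff)
  ultimately have "1 \<le> real_of_int n"
    by linarith
  then have "2 * pi * 1 \<le> 2 * pi * of_int n"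
    by (intro mult_left_mono) auto
  then have "Im w = 0 \<and> Im w' = 2 * pi"
    using im assms(1,2) unfolding log_strip_iff by linarith
  with re show ?thesis
    by (auto simp: complex_eq_iff)
qed

text \<open>The integer a is the winding number of f. A logarithm H exists because the strip is
  contractible; its jump between the glued sides is a multiple of 2 pi i at each radius, and hence
  constant along the side.\<close>

lemma periodic_log:
  fixes f :: "complex \<Rightarrow> complex"
  assumes "continuous_on {w. 1 \<le> norm w \<and> norm w \<le> 2} f"
    and "\<And>w. 1 \<le> norm w \<Longrightarrow> norm w \<le> 2 \<Longrightarrow> f w \<noteq> 0"
  obtains H a where "continuous_on log_strip H" "\<And>w. w \<in> log_strip \<Longrightarrow> f (exp w) = exp (H w)"
    "\<And>r. 0 \<le> r \<Longrightarrow> r \<le> ln 2 \<Longrightarrow>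
       H (of_real r + 2 * of_real pi * \<i>) - H (of_real r) = 2 * of_real pi * \<i> * of_int a"
proof -
  have cont: "continuous_on log_strip (\<lambda>w. f (exp w))"
    by (rule continuous_on_compose2[OF assms(1)])
      (use exp_log_strip in \<open>auto intro!: continuous_intros\<close>)
  have nz: "f (exp w) \<noteq> 0" if "w \<in> log_strip" for w
    using assms(2) exp_log_strip that by blast
  obtain H where H: "continuous_on log_strip H" "\<And>w. w \<in> log_strip \<Longrightarrow> f (exp w) = exp (H w)"
    using continuous_logarithm_on_contractible[OF cont _ nz] convex_imp_contractible[of log_strip]
      convex_box(1) unfolding log_strip_def by blast
  define g where "g = (\<lambda>r. H (of_real r + 2 * of_real pi * \<i>) - H (of_real r))"
  have mem: "complex_of_real r + 2 * of_real pi * \<i> \<in> log_strip" "complex_of_real r \<in> log_strip"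
    if "r \<in> {0..ln 2}" for r
    using that by (auto simp: log_strip_iff)
  have "continuous_on {0..ln 2} g"
    unfolding g_def
    by (intro continuous_intros continuous_on_compose2[OF H(1)]) (use mem in auto)
  moreover have per: "exp (g r) = 1" if r: "r \<in> {0..ln 2}" for r
  proof -
    have "exp (complex_of_real r + 2 * of_real pi * \<i>) = exp (complex_of_real r)"
      by (simp add: exp_add mult.commute mult.left_commute)
    then have "exp (H (of_real r + 2 * of_real pi * \<i>)) = exp (H (of_real r))"
      using H(2)[OF mem(1)[OF r]] H(2)[OF mem(2)[OF r]] by simp
    then show ?thesis
      by (simp add: g_def exp_diff)
  qed
  ultimately have "g constant_on {0..ln 2}"
    by (intro exp_eq_1_constant_on) auto
  then obtain c where c: "\<And>r. r \<in> {0..ln 2} \<Longrightarrow> g r = c"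
    unfolding constant_on_def by blast
  have "exp c = 1"
    using per[of 0] c[of 0] by simp
  then obtain a :: int where "c = 2 * of_real pi * \<i> * of_int a"
    unfolding exp_eq_1 by (auto simp: complex_eq_iff)
  then have "H (of_real r + 2 * of_real pi * \<i>) - H (of_real r) = 2 * of_real pi * \<i> * of_int a"
    if "0 \<le> r" "r \<le> ln 2" for r
    using c[of r] that by (simp add: g_def)
  with H show thesis
    by (rule that)
qed

text \<open>The first cohomology group of the annulus has rank one.\<close>

lemma annulus_dependent_maps:
  fixes f g :: "complex \<Rightarrow> complex"
  defines "A \<equiv> {w::complex. 1 \<le> norm w \<and> norm w \<le> 2}"
  assumes "continuous_on A f" "continuous_on A g"
    and "\<And>w. w \<in> A \<Longrightarrow> f w \<noteq> 0" "\<And>w. w \<in> A \<Longrightarrow> g w \<noteq> 0"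
  obtains m n :: int and h where "m \<noteq> 0 \<or> n \<noteq> 0" "continuous_on A h"
    "\<And>w. w \<in> A \<Longrightarrow> exp (h w) = f w powi m * g w powi n"
proof -
  obtain Hf a where Hf: "continuous_on log_strip Hf"
    "\<And>w. w \<in> log_strip \<Longrightarrow> f (exp w) = exp (Hf w)"
    "\<And>r. 0 \<le> r \<Longrightarrow> r \<le> ln 2 \<Longrightarrow>
       Hf (of_real r + 2 * of_real pi * \<i>) - Hf (of_real r) = 2 * of_real pi * \<i> * of_int a"
    using periodic_log[of f] assms unfolding A_def by blast
  obtain Hg b where Hg: "continuous_on log_strip Hg"
    "\<And>w. w \<in> log_strip \<Longrightarrow> g (exp w) = exp (Hg w)"
    "\<And>r. 0 \<le> r \<Longrightarrow> r \<le> ln 2 \<Longrightarrow>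
       Hg (of_real r + 2 * of_real pi * \<i>) - Hg (of_real r) = 2 * of_real pi * \<i> * of_int b"
    using periodic_log[of g] assms unfolding A_def by blast
  \<comment> \<open>The exponents (b, -a) cancel the winding numbers (a, b), so the combined
    logarithm has no jump. If a = b = 0, that pair would be trivial and (1, 0) is taken.\<close>
  define m n where "m = (if a = 0 \<and> b = 0 then 1 else b)" and "n = (if a = 0 \<and> b = 0 then 0 else - a)"
  define H where "H = (\<lambda>w. of_int m * Hf w + of_int n * Hg w)"
  have contH: "continuous_on log_strip H"
    unfolding H_def by (intro continuous_intros Hf Hg)
  have H_per: "H (of_real r + 2 * of_real pi * \<i>) = H (of_real r)" if "0 \<le> r" "r \<le> ln 2" for r
  proof -
    have "H (of_real r + 2 * of_real pi * \<i>) - H (of_real r) =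
      of_int m * (Hf (of_real r + 2 * of_real pi * \<i>) - Hf (of_real r)) +
      of_int n * (Hg (of_real r + 2 * of_real pi * \<i>) - Hg (of_real r))"
      unfolding H_def by (simp add: algebra_simps)
    also have "\<dots> = 0"
      unfolding Hf(3)[OF that] Hg(3)[OF that] by (auto simp: m_def n_def algebra_simps)
    finally show ?thesis by simp
  qed
  have H_exp: "H w = H w'" if "w \<in> log_strip" "w' \<in> log_strip" "exp w = exp w'" for w w'
    using that
  proof (induction "Im w" "Im w'" arbitrary: w w' rule: linorder_wlog)
    case le
    show ?case
    proof (cases "w = w'")
      case False
      have eq: "w = of_real (Re w)" "w' = of_real (Re w) + 2 * of_real pi * \<i>"
        using exp_log_strip_eq[OF le(2-4) False le(1)] by auto
      have "H (of_real (Re w) + 2 * of_real pi * \<i>) = H (of_real (Re w))"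
        using le(2) by (intro H_per) (auto simp: log_strip_iff)
      then show ?thesis
        using eq by metis
    qed simp
  next
    case sym
    show ?case
      using sym(1)[of w' w] sym(2-4) by simp
  qed
  \<comment> \<open>By \<open>H_exp\<close> the value does not depend on the preimage chosen in the
    strip.\<close>
  define h where "h = (\<lambda>z. H (SOME w. w \<in> log_strip \<and> exp w = z))"
  have h: "h (exp w) = H w" if "w \<in> log_strip" for w
  proof -
    define w' where "w' = (SOME w'. w' \<in> log_strip \<and> exp w' = exp w)"
    have "w' \<in> log_strip \<and> exp w' = exp w"
      unfolding w'_def by (rule someI[of _ w]) (use that in simp)
    then have "H w' = H w"
      using H_exp that by blast
    then show ?thesis
      by (simp add: h_def w'_def)
  qed
  show thesis
  proof
    show "m \<noteq> 0 \<or> n \<noteq> 0"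
      by (auto simp: m_def n_def)
    have A: "A = exp ` log_strip"
      unfolding A_def exp_log_strip ..
    have compact: "compact log_strip"
      by (simp add: log_strip_def)
    \<comment> \<open>Continuity of h holds because exp is a quotient map on the compact strip: the
      preimage of a closed set under h is the exp image of a compact set.\<close>
    have "closed (h -` B \<inter> A)" if "closed B" for B
    proof -
      have "h -` B \<inter> A = exp ` (log_strip \<inter> H -` B)"
        using h unfolding A by auto
      moreover have "closed (log_strip \<inter> H -` B)"
        using continuous_closed_preimage[OF contH _ that] compact compact_imp_closed by blast
      then have "compact (log_strip \<inter> (log_strip \<inter> H -` B))"
        using compact by (rule compact_Int_closed[rotated])
      then have "compact (log_strip \<inter> H -` B)"
        by (simp flip: Int_assoc)
      then have "compact (exp ` (log_strip \<inter> H -` B))"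
        by (intro compact_continuous_image continuous_intros)
      ultimately show ?thesis
        by (simp add: compact_imp_closed)
    qed
    moreover have "closed A"
      unfolding A using compact
      by (intro compact_imp_closed compact_continuous_image continuous_intros)
    ultimately show "continuous_on A h"
      by (simp add: continuous_on_closed_vimage)
    show "exp (h w) = f w powi m * g w powi n" if w: "w \<in> A" for w
    proof -
      obtain v where v: "v \<in> log_strip" "w = exp v"
        using w unfolding A by blast
      show ?thesis
        using Hf(2)[OF v(1)] Hg(2)[OF v(1)]
        by (simp add: v h H_def exp_add exp_power_int)
    qed
  qed
qed

section \<open>How the disks and bands of the surface meet\<close>

lemma fence_band_eq_image:
  "fence_band m (i, j) =
     (\<lambda>(s, t). (sin (pi * s) * (1 - t), real m + t * cos (pi * s), - real i - (real j - real i) * s)) `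
       ({0..1} \<times> {-1/4..1/4})"
  unfolding fence_band_def by (force simp: abs_le_iff)

lemma compact_fence_band: "compact (fence_band m v)"
proof (cases v)
  case (Pair i j)
  show ?thesis
    unfolding Pair fence_band_eq_image case_prod_beta
    by (intro compact_continuous_image continuous_intros compact_Times) auto
qed

lemma connected_fence_band: "connected (fence_band m v)"
proof (cases v)
  case (Pair i j)
  show ?thesis
    unfolding Pair fence_band_eq_image case_prod_beta
    by (intro connected_continuous_image continuous_intros connected_Times) auto
qed

lemma fence_disk_eq_Times: "fence_disk n i = {-1..0} \<times> {-1..real n} \<times> {- real i}"
  by (auto simp: fence_disk_def)

lemma compact_fence_disk: "compact (fence_disk n i)"
  unfolding fence_disk_eq_Times by (intro compact_Times) auto

lemma connected_fence_disk: "connected (fence_disk n i)"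
  unfolding fence_disk_eq_Times by (intro connected_Times) auto

text \<open>For 0 < s < 1 both \<open>sin (pi * s)\<close> and \<open>1 - t\<close> are positive, so
  a band touches the half-space of the disks only along its two ends.\<close>

lemma fence_band_left_of_0:
  assumes "(x, y, z) \<in> fence_band m (i, j)" "x \<le> 0"
  shows "z = - real i \<or> z = - real j"
proof -
  obtain s t where st: "0 \<le> s" "s \<le> 1" "\<bar>t\<bar> \<le> 1/4" "x = sin (pi * s) * (1 - t)"
    "z = - real i - (real j - real i) * s"
    using assms(1) unfolding fence_band_def by auto
  have "s = 0 \<or> s = 1"
  proof (rule ccontr)
    assume "\<not> (s = 0 \<or> s = 1)"
    then have "0 < sin (pi * s)"
      using st(1,2) by (intro sin_gt_zero) auto
    then have "0 < x"
      using st(3) unfolding st(4) by (intro mult_pos_pos) auto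
    with assms(2) show False
      by simp
  qed
  then show ?thesis
    using st(5) by auto
qed

lemma fence_band_disk_level:
  assumes "p \<in> fence_band m (i, j)" "p \<in> fence_disk n k"
  shows "k = i \<or> k = j"
proof (cases p)
  case (fields x y z)
  have "x \<le> 0" "z = - real k"
    using assms(2) by (auto simp: fields fence_disk_def)
  with fence_band_left_of_0[of x y z m i j] assms(1) show ?thesis
    by (auto simp: fields)
qed

lemma fence_disks_disjoint:
  "p \<in> fence_disk n i \<Longrightarrow> p \<in> fence_disk n j \<Longrightarrow> i = j"
  by (auto simp: fence_disk_def)

lemma fence_bands_disjoint:
  assumes "p \<in> fence_band m v" "p \<in> fence_band m' v'"
  shows "m = m'"
proof -
  have near: "\<bar>fst (snd p) - real m\<bar> \<le> 1/4" if p: "p \<in> fence_band m v" for m v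
  proof -
    obtain i j where v: "v = (i, j)" by fastforce
    obtain s t where "p = (sin (pi * s) * (1 - t), real m + t * cos (pi * s), - real i - (real j - real i) * s)"
      and "\<bar>t\<bar> \<le> 1/4"
      using p unfolding fence_band_def v by blast
    then have "fst (snd p) = real m + t * cos (pi * s)" "\<bar>t\<bar> \<le> 1/4"
      by simp_all
    moreover have "\<bar>t * cos (pi * s)\<bar> \<le> \<bar>t\<bar> * 1"
      unfolding abs_mult by (intro mult_left_mono) auto
    ultimately show ?thesis
      by simp
  qed
  show ?thesis
    using near[OF assms(1)] near[OF assms(2)] by linarith
qed

lemma fence_band_ends:
  "(0, real m, - real i) \<in> fence_band m (i, j)" "(0, real m, - real j) \<in> fence_band m (i, j)"
  unfolding fence_band_eq_image by (force intro: image_eqI[of _ _ "(0, 0)"], force intro: image_eqI[of _ _ "(1, 0)"])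

lemma fence_disk_front: "m \<le> n \<Longrightarrow> (0, real m, - real i) \<in> fence_disk n i"
  by (auto simp: fence_disk_def)

text \<open>A set of lines that no segment leaves splits the surface into two disjoint closed
  pieces: the disks and bands belonging to the set, and the remaining ones.\<close>

lemma linked_by_if_connected_surface:
  assumes F: "is_fence F" and conn: "connected (fence_surface F)"
  shows "linked_by (set (snd F)) {1..fst F}"
  unfolding linked_by_def
proof (intro allI impI)
  fix X assume X: "\<forall>(i, j) \<in> set (snd F). i \<in> X \<longleftrightarrow> j \<in> X"
  let ?n = "length (snd F)"
  \<comment> \<open>A band is assigned by its upper line; since no segment leaves X, its lower line
    lies on the same side.\<close>
  define part where "part = (\<lambda>Y. (\<Union>i \<in> {1..fst F} \<inter> Y. fence_disk ?n i) \<union>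
    (\<Union>m \<in> {m. m < ?n \<and> fst (snd F ! m) \<in> Y}. fence_band m (snd F ! m)))"
  have comp: "closed (part Y)" for Y
    unfolding part_def by (intro closed_Un closed_UN) (auto intro: compact_imp_closed compact_fence_band compact_fence_disk)
  have cover: "fence_surface F \<subseteq> part X \<union> part (- X)"
    unfolding part_def fence_surface_def by blast
  have seg: "fst (snd F ! m) \<in> X \<longleftrightarrow> snd (snd F ! m) \<in> X" if "m < ?n" for m
    using X nth_mem[OF that] by fastforce
  have lev: "k \<in> X \<longleftrightarrow> fst (snd F ! m) \<in> X"
    if "m < ?n" "p \<in> fence_band m (snd F ! m)" "p \<in> fence_disk ?n k" for m p k
    using fence_band_disk_level[of p m "fst (snd F ! m)" "snd (snd F ! m)" ?n k] seg[OF that(1)] that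
    by auto
  have disj: "part X \<inter> part (- X) = {}"
  proof (rule ccontr)
    assume "part X \<inter> part (- X) \<noteq> {}"
    then obtain p where p: "p \<in> part X" "p \<in> part (- X)"
      by blast
    from p(1) consider k where "k \<in> X" "p \<in> fence_disk ?n k"
      | m where "m < ?n" "fst (snd F ! m) \<in> X" "p \<in> fence_band m (snd F ! m)"
      unfolding part_def by blast
    moreover from p(2) consider k where "k \<notin> X" "p \<in> fence_disk ?n k"
      | m where "m < ?n" "fst (snd F ! m) \<notin> X" "p \<in> fence_band m (snd F ! m)"
      unfolding part_def by blast
    ultimately show False
      using lev fence_disks_disjoint fence_bands_disjoint by cases (metis | cases; metis)+
  qed
  have disk: "(0, 0, - real k) \<in> part Y \<inter> fence_surface F" if "k \<in> {1..fst F}" "k \<in> Y" for k Y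
    using that fence_disk_front[of 0 ?n k] unfolding part_def fence_surface_def by auto
  show "{1..fst F} \<subseteq> X \<or> {1..fst F} \<inter> X = {}"
  proof (rule ccontr)
    assume "\<not> ?thesis"
    then obtain k l where "k \<in> {1..fst F}" "k \<in> X" "l \<in> {1..fst F}" "l \<in> - X"
      by blast
    then have "part X \<inter> fence_surface F \<noteq> {}" "part (- X) \<inter> fence_surface F \<noteq> {}"
      using disk by blast+
    moreover have "part X \<inter> part (- X) \<inter> fence_surface F = {}"
      using disj by simp
    moreover note comp cover
    ultimately show False
      using conn[unfolded connected_closed] by metis
  qed
qed

section \<open>Circle-valued maps attached to bands\<close>

definition surface_off_band :: "fence \<Rightarrow> nat \<Rightarrow> (real \<times> real \<times> real) set" where
  "surface_off_band F e =
     (\<Union>i \<in> {1..fst F}. fence_disk (length (snd F)) i) \<union>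
     (\<Union>m \<in> {..<length (snd F)} - {e}. fence_band m (snd F ! m))"

text \<open>Runs once around the unit circle along the band at position \<open>e\<close>.\<close>

definition band_parameter :: "nat \<times> nat \<Rightarrow> real \<times> real \<times> real \<Rightarrow> complex" where
  "band_parameter v p =
     2 * of_real pi * \<i> * of_real ((- snd (snd p) - real (fst v)) / (real (snd v) - real (fst v)))"

text \<open>The height recovers s, so the exponential is 1 at both ends of the band and fits the
  constant 1 elsewhere. In cohomology this map counts signed passages through the band.\<close>

definition around_band :: "fence \<Rightarrow> nat \<Rightarrow> real \<times> real \<times> real \<Rightarrow> complex" where
  "around_band F e p =
     (if p \<in> fence_band e (snd F ! e) then exp (band_parameter (snd F ! e) p) else 1)"

lemma continuous_band_parameter: "continuous_on A (band_parameter v)"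
  unfolding band_parameter_def divide_inverse by (intro continuous_intros)

lemma around_band_off_band:
  assumes "is_fence F" "e < length (snd F)" "p \<in> surface_off_band F e"
  shows "around_band F e p = 1"
proof (cases "p \<in> fence_band e (snd F ! e)")
  case True
  obtain i j where ij: "snd F ! e = (i, j)" by fastforce
  have "i < j"
    using assms(1,2) nth_mem[OF assms(2)] unfolding is_fence_def ij by auto
  obtain k where k: "p \<in> fence_disk (length (snd F)) k"
    using assms(3) True fence_bands_disjoint unfolding surface_off_band_def by blast
  then have "k = i \<or> k = j"
    using True fence_band_disk_level unfolding ij by blast
  moreover have "snd (snd p) = - real k"
    using k by (auto simp: fence_disk_def)
  ultimately have "band_parameter (i, j) p = 0 \<or> band_parameter (i, j) p = 2 * of_real pi * \<i>"
    using \<open>i < j\<close> by (auto simp: band_parameter_def)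
  then show ?thesis
    using True by (auto simp: around_band_def ij)
qed (simp add: around_band_def)

lemma continuous_around_band:
  assumes "is_fence F" "e < length (snd F)"
  shows "continuous_on (fence_surface F) (around_band F e)"
proof -
  let ?B = "fence_band e (snd F ! e)"
  have S: "fence_surface F = ?B \<union> surface_off_band F e"
    using assms(2) unfolding fence_surface_def surface_off_band_def by blast
  have "continuous_on ?B (around_band F e)"
    by (subst continuous_on_cong[OF refl, of _ _ "\<lambda>p. exp (band_parameter (snd F ! e) p)"])
      (auto simp: around_band_def intro!: continuous_intros continuous_band_parameter)
  moreover have "continuous_on (surface_off_band F e) (around_band F e)"
    by (subst continuous_on_cong[OF refl, of _ _ "\<lambda>p. 1"]) (auto simp: around_band_off_band assms)
  moreover have "closed ?B" "closed (surface_off_band F e)"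
    unfolding surface_off_band_def
    by (auto intro!: compact_imp_closed compact_UN compact_Un compact_fence_band compact_fence_disk)
  ultimately show ?thesis
    unfolding S by (intro continuous_on_closed_Un) auto
qed

text \<open>
  If two bands could be cut without disconnecting the surface, then the maps running around these
  bands would be independent in cohomology.
\<close>

lemma annulus_two_bands_separate:
  assumes F: "annulus_fence F" and e: "e < length (snd F)" "e' < length (snd F)" "e \<noteq> e'"
  shows "\<not> linked_by ((!) (snd F) ` ({..<length (snd F)} - {e, e'})) {1..fst F}"
proof
  let ?n = "length (snd F)" and ?S = "fence_surface F" and ?A = "{w::complex. 1 \<le> norm w \<and> norm w \<le> 2}"
  assume linked: "linked_by ((!) (snd F) ` ({..<?n} - {e, e'})) {1..fst F}"
  have fence: "is_fence F" and "?S homeomorphic ?A"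
    using F by (auto simp: annulus_fence_def)
  then obtain \<phi> \<psi> where hom: "homeomorphism ?S ?A \<phi> \<psi>"
    unfolding homeomorphic_def by blast
  let ?f = "around_band F e" and ?g = "around_band F e'"
  have nz: "around_band F d p \<noteq> 0" for d p
    by (simp add: around_band_def)
  have cont: "continuous_on ?A (\<lambda>w. around_band F d (\<psi> w))" if "d < ?n" for d
    using hom by (intro continuous_on_compose2[OF continuous_around_band[OF fence that], of ?A \<psi>])
      (auto simp: homeomorphism_def)
  obtain a b :: int and h0 where ab: "a \<noteq> 0 \<or> b \<noteq> 0" and h0: "continuous_on ?A h0"
    "\<And>w. w \<in> ?A \<Longrightarrow> exp (h0 w) = ?f (\<psi> w) powi a * ?g (\<psi> w) powi b"
    by (rule annulus_dependent_maps[OF cont[OF e(1)] cont[OF e(2)]]) (use nz in auto)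
  \<comment> \<open>On the surface, h is a continuous logarithm of the a-th power of one map times
    the b-th power of the other. The contradiction comes from following h along the two
    bands.\<close>
  define h where "h = (\<lambda>p. h0 (\<phi> p))"
  have conth: "continuous_on ?S h"
    unfolding h_def using hom
    by (intro continuous_on_compose2[OF h0(1), of ?S \<phi>]) (auto simp: homeomorphism_def)
  have exph: "exp (h p) = ?f p powi a * ?g p powi b" if "p \<in> ?S" for p
  proof -
    have "\<phi> p \<in> ?A" "\<psi> (\<phi> p) = p"
      using hom that by (auto simp: homeomorphism_def)
    then show ?thesis
      using h0(2)[of "\<phi> p"] by (simp add: h_def)
  qed
  have disk_sub: "fence_disk ?n k \<subseteq> ?S" if "k \<in> {1..fst F}" for k
    using that unfolding fence_surface_def by blast
  have band_sub: "fence_band m (snd F ! m) \<subseteq> ?S" if "m < ?n" for m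
    using that unfolding fence_surface_def by blast
  have one: "?f p = 1 \<and> ?g p = 1"
    if "p \<in> surface_off_band F e" "p \<in> surface_off_band F e'" for p
    using around_band_off_band[OF fence] e that by blast
  have const: "h p = h q"
    if "connected T" "T \<subseteq> ?S" "T \<subseteq> surface_off_band F e" "T \<subseteq> surface_off_band F e'"
      "p \<in> T" "q \<in> T" for T p q
  proof -
    have "h constant_on T"
    proof (rule exp_eq_1_constant_on[OF that(1)])
      show "continuous_on T h"
        using conth that(2) by (rule continuous_on_subset)
      fix p assume "p \<in> T"
      with that(2-4) have "p \<in> ?S" "p \<in> surface_off_band F e" "p \<in> surface_off_band F e'"
        by blast+
      then show "exp (h p) = 1"
        using exph one by simp
    qed
    then show ?thesis
      using that(5,6) unfolding constant_on_def by metis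
  qed
  \<comment> \<open>On a disk both maps are 1, so h is constant there; v k is its value on the disk
    k. Bands other than the two chosen ones transport this value between disks.\<close>
  define v where "v = (\<lambda>k. h (0, 0, - real k))"
  have v: "h p = v k" if "p \<in> fence_disk ?n k" "k \<in> {1..fst F}" for p k
    unfolding v_def
  proof (rule const[OF connected_fence_disk disk_sub[OF that(2)] _ _ that(1)])
    show "(0, 0, - real k) \<in> fence_disk ?n k"
      using fence_disk_front[of 0 ?n k] by simp
  qed (use that(2) in \<open>auto simp: surface_off_band_def\<close>)
  have seg: "i \<in> {1..fst F}" "j \<in> {1..fst F}" "i < j" if "m < ?n" "snd F ! m = (i, j)" for m i j
    using fence nth_mem[OF that(1)] that(2) unfolding is_fence_def by auto
  have ends: "h (0, real m, - real i) = v i" "h (0, real m, - real j) = v j"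
    if "m < ?n" "snd F ! m = (i, j)" for m i j
    using v fence_disk_front[of m ?n] seg[OF that] that(1) by auto
  have v_eq: "v k = v l" if "k \<in> {1..fst F}" "l \<in> {1..fst F}" for k l
  proof -
    have "i \<in> {i. v i = v l} \<longleftrightarrow> j \<in> {i. v i = v l}"
      if ij: "(i, j) \<in> (!) (snd F) ` ({..<?n} - {e, e'})" for i j
    proof -
      obtain m where "(i, j) = snd F ! m" "m \<in> {..<?n} - {e, e'}"
        using ij by (rule imageE)
      then have m: "m < ?n" "m \<noteq> e" "m \<noteq> e'" "snd F ! m = (i, j)"
        by auto
      have "fence_band m (snd F ! m) \<subseteq> surface_off_band F d" if "d \<noteq> m" for d
        using that m unfolding surface_off_band_def by blast
      then have "h (0, real m, - real i) = h (0, real m, - real j)"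
        using m by (intro const[OF connected_fence_band band_sub[OF m(1)]])
          (auto simp: m(4) fence_band_ends)
      then show ?thesis
        using ends[OF m(1,4)] by simp
    qed
    then have "k \<in> {i. v i = v l}"
      by (rule linked_byD[OF linked _ that(2) _ that(1)]) auto
    then show ?thesis by simp
  qed
  \<comment> \<open>Along the band, h differs from c times the band parameter by a constant. The
    parameter gains 2 pi i from end to end, while h has equal values at the ends by
    \<open>v_eq\<close>.\<close>
  have zero: "c = 0"
    if d: "d < ?n" and eq: "\<And>p. p \<in> fence_band d (snd F ! d) \<Longrightarrow> exp (h p) = around_band F d p powi c"
    for d and c :: int
  proof -
    obtain i j where ij: "snd F ! d = (i, j)" by fastforce
    let ?k = "\<lambda>p. h p - of_int c * band_parameter (i, j) p"
    have "?k constant_on fence_band d (i, j)"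
    proof (rule exp_eq_1_constant_on[OF connected_fence_band])
      show "continuous_on (fence_band d (i, j)) ?k"
        using band_sub[OF d] conth
        by (intro continuous_intros continuous_band_parameter) (auto simp: ij intro: continuous_on_subset)
      show "exp (?k p) = 1" if "p \<in> fence_band d (i, j)" for p
        using eq[of p] that by (simp add: ij exp_diff around_band_def exp_power_int)
    qed
    then have "?k (0, real d, - real i) = ?k (0, real d, - real j)"
      using fence_band_ends unfolding constant_on_def by metis
    then have "of_int c * (2 * of_real pi * \<i>) = 0"
      using ends[OF d ij] v_eq[OF seg(1,2)[OF d ij]] seg(3)[OF d ij]
      by (simp add: band_parameter_def)
    then show ?thesis
      by simp
  qed
  have off: "around_band F d' p = 1"
    if "d < ?n" "d' < ?n" "d \<noteq> d'" "p \<in> fence_band d (snd F ! d)" for d d' p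
    using that by (intro around_band_off_band[OF fence]) (auto simp: surface_off_band_def)
  \<comment> \<open>On one of the two bands the other map is 1, so only one exponent
    remains.\<close>
  have "a = 0"
    using off[OF e(1,2,3)] exph band_sub[OF e(1)] by (intro zero[OF e(1)]) auto
  moreover have "b = 0"
    using off[OF e(2,1)] e(3) exph band_sub[OF e(2)] by (intro zero[OF e(2)]) auto
  ultimately show False
    using ab by simp
qed

text \<open>Grows a spanning tree from v, each step adding one vertex and one edge. Of the tree only
  its connectedness and the bound on its number of edges are recorded.\<close>

lemma linked_by_few:
  assumes V: "finite V" "v \<in> V" and linked: "linked_by (f ` M) V"
    and sub: "f ` M \<subseteq> V \<times> V"
  obtains N where "N \<subseteq> M" "finite N" "card N < card V" "linked_by (f ` N) V"
proof -
  have "\<exists>W N. W \<subseteq> V \<and> v \<in> W \<and> card W = Suc k \<and> N \<subseteq> M \<and> finite N \<and> card N \<le> k \<and> linked_by (f ` N) W"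
    if "k < card V" for k
    using that
  proof (induction k)
    case 0
    then show ?case
      using V(2) by (intro exI[of _ "{v}"] exI[of _ "{}"]) (auto simp: linked_by_def)
  next
    case (Suc k)
    then obtain W N where W: "W \<subseteq> V" "v \<in> W" "card W = Suc k" "N \<subseteq> M" "finite N" "card N \<le> k"
      "linked_by (f ` N) W"
      by auto
    \<comment> \<open>W is a proper nonempty part of V, so the cut condition applied to W itself
      yields an edge leaving W.\<close>
    have "\<not> V \<subseteq> W"
      using W(1,3) Suc.prems by (metis less_irrefl subset_antisym)
    moreover have "V \<inter> W \<noteq> {}"
      using W V by blast
    ultimately have "\<not> (\<forall>(i, j) \<in> f ` M. i \<in> W \<longleftrightarrow> j \<in> W)"
      using linked[unfolded linked_by_def, rule_format, of W] by blast
    then obtain e where "e \<in> f ` M" "fst e \<in> W \<longleftrightarrow> snd e \<notin> W"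
      unfolding case_prod_unfold by blast
    then obtain m i j where m: "m \<in> M" "f m = (i, j)" "i \<in> W \<longleftrightarrow> j \<notin> W"
      by (metis imageE prod.collapse)
    define x where "x = (if i \<in> W then j else i)"
    have x: "x \<in> V" "x \<notin> W"
      using sub m by (auto simp: x_def)
    show ?case
    proof (intro exI conjI)
      show "insert x W \<subseteq> V" "v \<in> insert x W" "insert m N \<subseteq> M" "finite (insert m N)"
        using x W m by auto
      show "card (insert x W) = Suc (Suc k)"
        using x W(1,3) V(1) by (simp add: finite_subset)
      show "card (insert m N) \<le> Suc k"
        using W(5,6) by (simp add: card_insert_if)
      show "linked_by (f ` insert m N) (insert x W)"
        unfolding linked_by_def
      proof (intro allI impI)
        fix X assume X: "\<forall>(i, j) \<in> f ` insert m N. i \<in> X \<longleftrightarrow> j \<in> X"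
        then have "W \<subseteq> X \<or> W \<inter> X = {}"
          using W(7)[unfolded linked_by_def, rule_format, of X] by blast
        moreover have "i \<in> X \<longleftrightarrow> j \<in> X"
          using X m(2) by auto
        ultimately show "insert x W \<subseteq> X \<or> insert x W \<inter> X = {}"
          using m(3) unfolding x_def by (auto split: if_splits)
      qed
    qed
  qed
  moreover have "0 < card V"
    using V by (auto simp: card_gt_0_iff)
  ultimately obtain W N where W: "W \<subseteq> V" "card W = card V" "N \<subseteq> M" "finite N"
    "card N < card V" "linked_by (f ` N) W"
    by (metis Suc_pred diff_less le_imp_less_Suc zero_less_one One_nat_def)
  then have "W = V"
    using V(1) by (simp add: card_subset_eq)
  with W show thesis
    using that by blast
qed

proposition annulus_fence_linked:
  assumes "annulus_fence F"
  shows "linked_by (set (snd F)) {1..fst F}" and "length (snd F) \<le> fst F"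
proof -
  let ?n = "length (snd F)"
  have fence: "is_fence F" and hom: "fence_surface F homeomorphic {w::complex. 1 \<le> norm w \<and> norm w \<le> 2}"
    using assms by (auto simp: annulus_fence_def)
  have "connected {w::complex. 1 \<le> norm w \<and> norm w \<le> 2}"
    using connected_annulus(4)[where 'N = complex and a = 0 and ?r1.0 = 1 and ?r2.0 = 2] by simp
  then have "connected (fence_surface F)"
    using hom homeomorphic_connectedness by blast
  then show linked: "linked_by (set (snd F)) {1..fst F}"
    using fence by (rule linked_by_if_connected_surface[rotated])
  have set: "(!) (snd F) ` {..<?n} = set (snd F)"
    by (auto simp: set_conv_nth image_iff)
  obtain N where N: "N \<subseteq> {..<?n}" "finite N" "card N < card {1..fst F}"
    "linked_by ((!) (snd F) ` N) {1..fst F}"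
  proof (rule linked_by_few[of "{1..fst F}" 1 "(!) (snd F)" "{..<?n}"])
    show "linked_by ((!) (snd F) ` {..<?n}) {1..fst F}"
      using linked set by simp
    show "(!) (snd F) ` {..<?n} \<subseteq> {1..fst F} \<times> {1..fst F}"
      using fence unfolding set is_fence_def by fastforce
  qed (use fence in \<open>auto simp: is_fence_def\<close>)
  show "?n \<le> fst F"
  proof (rule ccontr)
    assume "\<not> ?n \<le> fst F"
    \<comment> \<open>More than b segments against fewer than b in the spanning tree leave two spare
      bands, and cutting both keeps the diagram connected.\<close>
    then have "2 \<le> card ({..<?n} - N)"
      using N by (simp add: card_Diff_subset)
    then obtain T where "T \<subseteq> {..<?n} - N" "card T = 2"
      using obtain_subset_with_card_n by metis
    then obtain e e' where e: "e \<in> {..<?n} - N" "e' \<in> {..<?n} - N" "e \<noteq> e'"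
      unfolding card_2_iff by blast
    then have "N \<subseteq> {..<?n} - {e, e'}"
      using N(1) by blast
    then have "linked_by ((!) (snd F) ` ({..<?n} - {e, e'})) {1..fst F}"
      using linked_by_mono[OF N(4)] by blast
    then show False
      using annulus_two_bands_separate[OF assms, of e e'] e by auto
  qed
qed

subsection \<open>Flows\<close>

text \<open>Lines minus segments is the Euler characteristic, so this says: connected, with at most
  one independent cycle. It is the combinatorial remnant of being an annulus that is carried along
  the moves.\<close>

definition tight :: "fence \<Rightarrow> bool" where
  "tight F \<longleftrightarrow> is_fence F \<and> linked_by (set (snd F)) {1..fst F} \<and> length (snd F) \<le> fst F"

text \<open>The coefficient at line k of the boundary of a labelled segment, oriented downwards;
  flows are thus the 1-cycles of the graph.\<close>

definition inflow :: "nat \<Rightarrow> nat \<times> nat \<times> int \<Rightarrow> int" where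
  "inflow k = (\<lambda>(i, j, e). if j = k then e else if i = k then - e else 0)"

definition ends :: "nat \<times> nat \<times> int \<Rightarrow> nat \<times> nat" where
  "ends = (\<lambda>(i, j, e). (i, j))"

definition flow :: "labelled_fence \<Rightarrow> bool" where
  "flow D \<longleftrightarrow> (\<forall>k \<in> {1..fst D}. (\<Sum>v \<leftarrow> snd D. inflow k v) = 0)"

text \<open>The labels have greatest common divisor 1; the divisor formulation is stable under the
  invertible label changes of slides. The zero flow is not primitive, as every d divides it.\<close>

definition primitive :: "labelled_fence \<Rightarrow> bool" where
  "primitive D \<longleftrightarrow> (\<forall>d. (\<forall>(i, j, e) \<in> set (snd D). d dvd e) \<longrightarrow> is_unit d)"

lemma inflow_simps [simp]:
  "inflow k (i, j, e) = (if j = k then e else if i = k then - e else 0)"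
  by (simp add: inflow_def)

lemma inflow_label_0: "inflow k (i, j, 0) = 0"
  by simp

lemma ends_simps [simp]: "ends (i, j, e) = (i, j)"
  by (simp add: ends_def)

lemma underlying_simps [simp]: "underlying (b, vs) = (b, map ends vs)"
  by (simp add: underlying_def ends_def)

lemma fst_underlying [simp]: "fst (underlying D) = fst D"
  and length_underlying [simp]: "length (snd (underlying D)) = length (snd D)"
  by (simp_all add: underlying_def)

lemma is_fence_underlying:
  "is_fence (underlying (b, vs)) \<longleftrightarrow>
     1 \<le> b \<and> (\<forall>(i, j, e) \<in> set vs. 1 \<le> i \<and> i < j \<and> j \<le> b)"
  by (fastforce simp: is_fence_def ends_def)

lemma linked_by_underlying:
  "linked_by (set (snd (underlying (b, vs)))) V \<longleftrightarrow>
     (\<forall>X. (\<forall>(i, j, e) \<in> set vs. i \<in> X \<longleftrightarrow> j \<in> X) \<longrightarrow> V \<subseteq> X \<or> V \<inter> X = {})"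
  by (simp add: linked_by_def ends_def case_prod_unfold)

lemma sum_inflow_interval:
  "i \<noteq> j \<Longrightarrow> (\<Sum>k \<in> {a<..b}. inflow k (i, j, e)) =
     e * (of_bool (a < j \<and> j \<le> b) - of_bool (a < i \<and> i \<le> b))"
proof -
  assume "i \<noteq> j"
  then have "inflow k (i, j, e) = (if j = k then e else 0) - (if i = k then e else 0)" for k
    by simp
  then show ?thesis
    by (simp only: sum_subtractf) (simp add: sum.delta of_bool_def)
qed

lemma sum_list_inflow_interval:
  assumes "flow (b, vs)" "{c<..d} \<subseteq> {1..b}"
  shows "(\<Sum>v \<leftarrow> vs. \<Sum>k \<in> {c<..d}. inflow k v) = 0"
proof -
  have "(\<Sum>v \<leftarrow> vs. \<Sum>k \<in> K. inflow k v) = (\<Sum>k \<in> K. \<Sum>v \<leftarrow> vs. inflow k v)" if "finite K" for K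
    using that by induction (simp_all add: sum_list_addf)
  then show ?thesis
    using assms by (auto simp: flow_def subset_iff intro!: sum.neutral)
qed

subsection \<open>The linking number and the rotation of a labelling\<close>

text \<open>
  The number \<open>pairing v w\<close>, for \<open>v\<close> to the left of \<open>w\<close>, counts the signed passages of \<open>w\<close> across
  the horizontal strands that start at the ends of \<open>v\<close> and run to the right past \<open>w\<close>. A strand ending
  at the bottom of \<open>w\<close> is counted as well; these are the right cusps.
\<close>

definition pairing :: "nat \<times> nat \<times> int \<Rightarrow> nat \<times> nat \<times> int \<Rightarrow> int" where
  "pairing = (\<lambda>(i, j, e) (k, l, f).
     e * f * (of_bool (k < j \<and> j \<le> l) - of_bool (k < i \<and> i \<le> l)))"

fun linking :: "(nat \<times> nat \<times> int) list \<Rightarrow> int" where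
  "linking [] = 0"
| "linking (v # vs) = (\<Sum>w \<leftarrow> vs. pairing v w) + linking vs"

lemma linking_append:
  "linking (us @ ws) = linking us + (\<Sum>u \<leftarrow> us. \<Sum>w \<leftarrow> ws. pairing u w) + linking ws"
  by (induction us) auto

text \<open>Localises a move: \<open>linking\<close> sees a block of consecutive segments only
  through its total pairing with what lies outside and its own linking.\<close>

lemma linking_replace:
  assumes "\<And>u. (\<Sum>v \<leftarrow> vs. pairing u v) = (\<Sum>v \<leftarrow> vs'. pairing u v)"
    and "\<And>w. (\<Sum>v \<leftarrow> vs. pairing v w) = (\<Sum>v \<leftarrow> vs'. pairing v w)"
    and "linking vs = linking vs'"
  shows "linking (us @ vs @ ws) = linking (us @ vs' @ ws)"
proof -
  have "(\<Sum>v \<leftarrow> xs. \<Sum>w \<leftarrow> ws. pairing v w) = (\<Sum>w \<leftarrow> ws. \<Sum>v \<leftarrow> xs. pairing v w)" for xs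
    by (induction xs) (simp_all add: sum_list_addf)
  then have "(\<Sum>v \<leftarrow> vs. \<Sum>w \<leftarrow> ws. pairing v w) = (\<Sum>v \<leftarrow> vs'. \<Sum>w \<leftarrow> ws. pairing v w)"
    using assms(2) by simp
  then show ?thesis
    using assms(1,3) by (simp add: linking_append)
qed

lemma linking_map:
  assumes "\<And>u w. u \<in> set vs \<Longrightarrow> w \<in> set vs \<Longrightarrow> pairing (f u) (f w) = pairing u w"
  shows "linking (map f vs) = linking vs"
  using assms by (induction vs) (simp_all add: o_def cong: map_cong)

lemma pairing_label_0 [simp]: "pairing (i, j, 0) w = 0" "pairing v (i, j, 0) = 0"
  by (simp_all add: pairing_def split: prod.split)

text \<open>Translates the pairing into inflows at the lines that w passes. The half-open interval
  excludes the upper line of w and includes its lower line, where the right cusps are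
  counted.\<close>

lemma pairing_eq_sum_inflow:
  assumes "fst v \<noteq> fst (snd v)"
  shows "pairing v (k, l, f) = f * (\<Sum>r \<in> {k<..l}. inflow r v)"
  using assms by (cases v) (simp add: sum_inflow_interval pairing_def del: inflow_simps)

text \<open>The direction in which the curve runs on a line is that of its first passage.\<close>

fun first_nonzero :: "int list \<Rightarrow> int" where
  "first_nonzero [] = 0"
| "first_nonzero (x # xs) = (if x = 0 then first_nonzero xs else x)"

lemma first_nonzero_append:
  "first_nonzero (xs @ ys) = (if first_nonzero xs = 0 then first_nonzero ys else first_nonzero xs)"
  by (induction xs) auto

lemma first_nonzero_uminus: "first_nonzero (map uminus xs) = - first_nonzero xs"
  by (induction xs) auto

lemma first_nonzero_eq_0_iff: "first_nonzero xs = 0 \<longleftrightarrow> (\<forall>x \<in> set xs. x = 0)"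
  by (induction xs) auto

lemma first_nonzero_all_0: "(\<And>x. x \<in> set xs \<Longrightarrow> x = 0) \<Longrightarrow> first_nonzero xs = 0"
  by (simp add: first_nonzero_eq_0_iff)

definition rotation :: "labelled_fence \<Rightarrow> int" where
  "rotation D = (\<Sum>(i, j, e) \<leftarrow> snd D. e) -
     (\<Sum>k \<in> {1..fst D}. first_nonzero (map (inflow k) (snd D)))"

text \<open>
  The part of the diagram with nonzero labels consists of disjoint cycles, and no other segment
  joins two lines visited by these cycles.
\<close>

definition cyclic :: "labelled_fence \<Rightarrow> bool" where
  "cyclic D \<longleftrightarrow>
     (\<forall>k \<in> {1..fst D}. length (filter (\<lambda>x. x \<noteq> 0) (map (inflow k) (snd D))) \<le> 2) \<and>
     (\<forall>(i, j, e) \<in> set (snd D). e = 0 \<longrightarrow>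
        (\<forall>v \<in> set (snd D). inflow i v = 0) \<or> (\<forall>v \<in> set (snd D). inflow j v = 0))"

subsection \<open>Inflations\<close>

lemma lift_line_neq [simp]: "lift_line p k \<noteq> p" "p \<noteq> lift_line p k"
  by (auto simp: lift_line_def)

lemma lift_line_less_iff [simp]: "lift_line p k < lift_line p l \<longleftrightarrow> k < l"
  by (auto simp: lift_line_def)

lemma lift_line_le_iff [simp]: "lift_line p k \<le> lift_line p l \<longleftrightarrow> k \<le> l"
  by (auto simp: lift_line_def)

lemma lift_line_eq_iff [simp]: "lift_line p k = lift_line p l \<longleftrightarrow> k = l"
  by (auto simp: lift_line_def)

lemma lift_line_bounds:
  assumes "1 \<le> p" "p \<le> b + 1"
  shows "1 \<le> lift_line p k \<longleftrightarrow> 1 \<le> k" "lift_line p k \<le> b + 1 \<longleftrightarrow> k \<le> b"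
  using assms by (auto simp: lift_line_def)

lemma lift_line_range:
  assumes "1 \<le> p" "p \<le> b + 1"
  shows "{1..b + 1} = insert p (lift_line p ` {1..b})"
proof (intro equalityI subsetI)
  fix k assume "k \<in> {1..b + 1}"
  then have "k = p \<or> (k = lift_line p k \<and> k \<in> {1..b}) \<or>
      (k = lift_line p (k - 1) \<and> k - 1 \<in> {1..b})"
    using assms by (cases k p rule: linorder_cases) (auto simp: lift_line_def)
  then show "k \<in> insert p (lift_line p ` {1..b})"
    by blast
qed (use assms in \<open>auto simp: lift_line_def split: if_splits\<close>)

lemma lift_seg_simps [simp]: "lift_seg p (i, j, e) = (lift_line p i, lift_line p j, e)"
  by (simp add: lift_seg_def)

lemma inflow_lift_seg [simp]:
  "inflow (lift_line p k) (lift_seg p v) = inflow k v" "inflow p (lift_seg p v) = 0"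
  by (cases v; simp)+

lemma pairing_lift_seg [simp]: "pairing (lift_seg p u) (lift_seg p w) = pairing u w"
  by (cases u; cases w) (simp add: pairing_def)

lemma inflation_fence:
  assumes "inflation D D'" "is_fence (underlying D')"
  shows "is_fence (underlying D)"
  using assms
proof cases
  case (1 p b q us ws)
  have "1 \<le> i \<and> i < j \<and> j \<le> b" if "(i, j, e) \<in> set us \<union> set ws" for i j e
  proof -
    have "lift_seg p (i, j, e) \<in> lift_seg p ` (set us \<union> set ws)"
      using that by (rule imageI)
    then have "lift_seg p (i, j, e) \<in> set (snd D')"
      unfolding 1 by (simp add: image_Un disj_ac del: lift_seg_simps)
    moreover have "is_fence (underlying (fst D', snd D'))"
      using assms(2) by simp
    ultimately have "1 \<le> lift_line p i \<and> lift_line p i < lift_line p j \<and> lift_line p j \<le> fst D'"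
      unfolding is_fence_underlying by auto
    then show ?thesis
      using lift_line_bounds[OF 1(3,4)] 1(2) by auto
  qed
  then have "is_fence (underlying (b, us @ ws))"
    using 1 unfolding is_fence_underlying by auto
  then show ?thesis
    using 1 by simp
qed

lemma inflation_length:
  assumes "inflation D D'"
  shows "fst D' = Suc (fst D)" "length (snd D') = Suc (length (snd D))"
  using assms by (cases, simp)+

text \<open>The new line hangs on one old line, so a set of lines that no segment leaves is
  determined by its trace on the old lines.\<close>

lemma inflation_linked:
  assumes "inflation D D'"
  shows "linked_by (set (snd (underlying D'))) {1..fst D'} \<longleftrightarrow>
    linked_by (set (snd (underlying D))) {1..fst D}"
  using assms
proof cases
  case (1 p b q us ws)
  note range = lift_line_range[OF 1(3,4)]
  let ?c = "\<lambda>vs X. \<forall>(i, j, e) \<in> set vs. i \<in> X \<longleftrightarrow> j \<in> X"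
  have split: "?c (snd D') X' \<longleftrightarrow>
      ?c (snd D) {k. lift_line p k \<in> X'} \<and> (p \<in> X' \<longleftrightarrow> lift_line p q \<in> X')" for X'
    unfolding 1 by (auto simp: min_def max_def ball_Un)
  have all: "({1..b + 1} \<subseteq> X' \<or> {1..b + 1} \<inter> X' = {}) \<longleftrightarrow>
      {1..b} \<subseteq> {k. lift_line p k \<in> X'} \<or> {1..b} \<inter> {k. lift_line p k \<in> X'} = {}"
    if "p \<in> X' \<longleftrightarrow> lift_line p q \<in> X'" for X'
  proof -
    have "q \<in> {1..b}"
      using 1(5,6) by simp
    then show ?thesis
      unfolding range using that by blast
  qed
  \<comment> \<open>The new line p joins the set exactly when its neighbour q belongs to it.\<close>
  have ex: "\<exists>X'. X = {k. lift_line p k \<in> X'} \<and> (p \<in> X' \<longleftrightarrow> lift_line p q \<in> X')" for X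
    by (rule exI[of _ "lift_line p ` X \<union> (if q \<in> X then {p} else {})"]) auto
  have "linked_by (set (snd (underlying D'))) {1..b + 1} \<longleftrightarrow>
      (\<forall>X'. ?c (snd D') X' \<longrightarrow> {1..b + 1} \<subseteq> X' \<or> {1..b + 1} \<inter> X' = {})"
    using linked_by_underlying[of "fst D'" "snd D'" "{1..b + 1}"] by simp
  also have "\<dots> \<longleftrightarrow> (\<forall>X. ?c (snd D) X \<longrightarrow> {1..b} \<subseteq> X \<or> {1..b} \<inter> X = {})"
    (is "?L \<longleftrightarrow> ?R")
  proof
    assume L: ?L
    show ?R
    proof (intro allI impI)
      fix X assume X: "?c (snd D) X"
      obtain X' where X': "X = {k. lift_line p k \<in> X'}" "p \<in> X' \<longleftrightarrow> lift_line p q \<in> X'"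
        using ex by blast
      then have "?c (snd D') X'"
        using X by (simp add: split)
      then show "{1..b} \<subseteq> X \<or> {1..b} \<inter> X = {}"
        using L all[OF X'(2)] X'(1) by simp
    qed
  next
    assume R: ?R
    show ?L
    proof (intro allI impI)
      fix X' assume "?c (snd D') X'"
      then have "?c (snd D) {k. lift_line p k \<in> X'}" "p \<in> X' \<longleftrightarrow> lift_line p q \<in> X'"
        by (simp_all add: split)
      then show "{1..b + 1} \<subseteq> X' \<or> {1..b + 1} \<inter> X' = {}"
        using R[rule_format, of "{k. lift_line p k \<in> X'}"] all[of X'] by simp
    qed
  qed
  also have "\<dots> \<longleftrightarrow> linked_by (set (snd (underlying D))) {1..b}"
    using linked_by_underlying[of "fst D" "snd D" "{1..b}"] by simp
  finally show ?thesis
    using 1 by simp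
qed

lemma inflation_tight:
  assumes "inflation D D'" "is_fence (underlying D')"
  shows "tight (underlying D') \<longleftrightarrow> tight (underlying D)"
  using assms inflation_fence inflation_linked inflation_length by (simp add: tight_def)

text \<open>The common core of the invariance proofs for inflations: the new line sees only zeros,
  and every old line sees its former passages with one zero inserted.\<close>

lemma inflation_sum_inflow:
  assumes "inflation D D'"
  obtains p where "{1..fst D'} = insert p (lift_line p ` {1..fst D})"
    "\<And>v. v \<in> set (snd D') \<Longrightarrow> inflow p v = 0"
    "\<And>k. \<exists>xs ys. map (inflow k) (snd D) = xs @ ys \<and> map (inflow (lift_line p k)) (snd D') = xs @ 0 # ys"
  using assms
proof cases
  case (1 p b q us ws)
  show ?thesis
  proof (rule that)
    show "{1..fst D'} = insert p (lift_line p ` {1..fst D})"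
      using lift_line_range[OF 1(3,4)] 1 by simp
    show "inflow p v = 0" if "v \<in> set (snd D')" for v
      using that 1 by auto
    show "\<exists>xs ys. map (inflow k) (snd D) = xs @ ys \<and> map (inflow (lift_line p k)) (snd D') = xs @ 0 # ys" for k
      by (rule exI[of _ "map (inflow k) us"], rule exI[of _ "map (inflow k) ws"]) (simp add: 1)
  qed
qed

lemma inflation_flow:
  assumes "inflation D D'"
  shows "flow D' \<longleftrightarrow> flow D"
proof -
  obtain p where p: "{1..fst D'} = insert p (lift_line p ` {1..fst D})"
    "\<And>v. v \<in> set (snd D') \<Longrightarrow> inflow p v = 0"
    "\<And>k. \<exists>xs ys. map (inflow k) (snd D) = xs @ ys \<and> map (inflow (lift_line p k)) (snd D') = xs @ 0 # ys"
    using inflation_sum_inflow[OF assms] by blast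
  have "(\<Sum>v \<leftarrow> snd D'. inflow (lift_line p k) v) = (\<Sum>v \<leftarrow> snd D. inflow k v)" for k
    using p(3)[of k] by auto
  moreover have "(\<Sum>v \<leftarrow> snd D'. inflow p v) = 0"
    using p(2) by (simp cong: map_cong)
  ultimately show ?thesis
    unfolding flow_def p(1) by simp
qed

lemma inflation_primitive:
  assumes "inflation D D'"
  shows "primitive D' \<longleftrightarrow> primitive D"
  using assms by cases (auto simp: primitive_def ball_Un case_prod_unfold lift_seg_def)

lemma inflation_linking:
  assumes "inflation D D'"
  shows "linking (snd D') = linking (snd D)"
  using assms
proof cases
  case (1 p b q us ws)
  have "linking (snd D') = linking (map (lift_seg p) (us @ ws))"
    by (simp add: 1 linking_append o_def)
  also have "\<dots> = linking (us @ ws)"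
    by (rule linking_map) simp
  finally show ?thesis
    by (simp add: 1)
qed

lemma inflation_rotation:
  assumes "inflation D D'"
  shows "rotation D' = rotation D"
proof -
  obtain p where p: "{1..fst D'} = insert p (lift_line p ` {1..fst D})"
    "\<And>v. v \<in> set (snd D') \<Longrightarrow> inflow p v = 0"
    "\<And>k. \<exists>xs ys. map (inflow k) (snd D) = xs @ ys \<and> map (inflow (lift_line p k)) (snd D') = xs @ 0 # ys"
    using inflation_sum_inflow[OF assms] by blast
  have "first_nonzero (map (inflow (lift_line p k)) (snd D')) = first_nonzero (map (inflow k) (snd D))" for k
    using p(3)[of k] by (auto simp: first_nonzero_append)
  moreover have "first_nonzero (map (inflow p) (snd D')) = 0"
    using p(2) by (intro first_nonzero_all_0) auto
  moreover have "p \<notin> lift_line p ` {1..fst D}"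
    by auto
  moreover have "inj_on (lift_line p) {1..fst D}"
    by (auto intro: inj_onI)
  moreover have "(\<Sum>(i, j, e) \<leftarrow> snd D'. e) = (\<Sum>(i, j, e) \<leftarrow> snd D. e)"
    using assms by cases (simp add: lift_seg_def case_prod_unfold o_def)
  ultimately show ?thesis
    unfolding rotation_def p(1) by (simp add: sum.reindex)
qed

text \<open>This is the direction that lifts cyclicity from the reduced diagram back to the original
  one. The new segment is harmless since the new line is not visited by the curve.\<close>

lemma inflation_cyclic:
  assumes "inflation D D'" "cyclic D"
  shows "cyclic D'"
  using assms(1)
proof cases
  case (1 p b q us ws)
  obtain p' where p': "{1..fst D'} = insert p' (lift_line p' ` {1..fst D})"
    "\<And>v. v \<in> set (snd D') \<Longrightarrow> inflow p' v = 0"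
    "\<And>k. \<exists>xs ys. map (inflow k) (snd D) = xs @ ys \<and> map (inflow (lift_line p' k)) (snd D') = xs @ 0 # ys"
    using inflation_sum_inflow[OF assms(1)] by blast
  have "length (filter (\<lambda>x. x \<noteq> 0) (map (inflow k) (snd D'))) \<le> 2" if k: "k \<in> {1..fst D'}" for k
  proof (cases "k = p'")
    case True
    then have "filter (\<lambda>x. x \<noteq> 0) (map (inflow k) (snd D')) = []"
      using p'(2) by (simp add: filter_empty_conv)
    then show ?thesis
      by (simp only: list.size)
  next
    case False
    then obtain l where l: "l \<in> {1..fst D}" "k = lift_line p' l"
      using k p'(1) by auto
    then have "length (filter (\<lambda>x. x \<noteq> 0) (map (inflow l) (snd D))) \<le> 2"
      using assms(2) by (simp add: cyclic_def)
    moreover obtain xs ys where "map (inflow l) (snd D) = xs @ ys"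
      "map (inflow (lift_line p' l)) (snd D') = xs @ 0 # ys"
      using p'(3) by blast
    ultimately show ?thesis
      unfolding l(2) by (simp del: filter_map)
  qed
  moreover have "(\<forall>v \<in> set (snd D'). inflow i v = 0) \<or> (\<forall>v \<in> set (snd D'). inflow j v = 0)"
    if e: "(i, j, 0) \<in> set (snd D')" for i j
  proof -
    have new: "\<forall>v \<in> set (snd D'). inflow p v = 0"
      using 1 by auto
    consider "i = p \<or> j = p" | i' j' where "i = lift_line p i'" "j = lift_line p j'" "(i', j', 0) \<in> set (snd D)"
      using e 1 by (auto simp: min_def max_def lift_seg_def split: if_splits)
    then show ?thesis
    proof cases
      case a: 1
      then show ?thesis using new by blast
    next
      case a: 2
      have "(\<forall>v \<in> set (snd D'). inflow (lift_line p l) v = 0)" if "\<forall>v \<in> set (snd D). inflow l v = 0" for l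
        using that by (auto simp: 1 inflow_label_0 simp del: inflow_simps lift_seg_simps)
      then show ?thesis
        using assms(2) a unfolding cyclic_def by fast
    qed
  qed
  ultimately show ?thesis
    unfolding cyclic_def by blast
qed

subsection \<open>Reduced diagrams\<close>

lemma deflations_invariant:
  assumes "deflation\<^sup>*\<^sup>* D R" "is_fence (underlying D)"
  shows "is_fence (underlying R) \<and> (tight (underlying R) \<longleftrightarrow> tight (underlying D)) \<and>
    (flow R \<longleftrightarrow> flow D) \<and> (primitive R \<longleftrightarrow> primitive D) \<and> (cyclic R \<longrightarrow> cyclic D) \<and>
    linking (snd R) = linking (snd D) \<and> rotation R = rotation D \<and>
    (length (snd R) = fst R \<longleftrightarrow> length (snd D) = fst D)"
  using assms(1)
proof induction
  case base
  then show ?case using assms(2) by simp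
next
  case (step R R')
  have infl: "inflation R' R"
    using step.hyps(2) by (simp add: deflation_def)
  have "is_fence (underlying R')"
    using inflation_fence[OF infl] step.IH by blast
  moreover have "tight (underlying R') \<longleftrightarrow> tight (underlying R)"
    using inflation_tight[OF infl] step.IH by blast
  moreover have "length (snd R') = fst R' \<longleftrightarrow> length (snd R) = fst R"
    using inflation_length[OF infl] by simp
  ultimately show ?case
    using step.IH inflation_flow[OF infl] inflation_primitive[OF infl] inflation_cyclic[OF infl]
      inflation_linking[OF infl] inflation_rotation[OF infl]
    by simp
qed

lemma deflations_end: "\<exists>R. deflation\<^sup>*\<^sup>* D R \<and> (\<nexists>R'. deflation R R')"
proof (induction "fst D" arbitrary: D rule: less_induct)
  case less
  show ?case
  proof (cases "\<exists>D'. deflation D D'")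
    case True
    then obtain D' where D': "deflation D D'" by blast
    then have "fst D' < fst D"
      using inflation_length(1)[of D' D] by (simp add: deflation_def)
    then obtain R where "deflation\<^sup>*\<^sup>* D' R" "\<nexists>R'. deflation R R'"
      using less by blast
    then show ?thesis
      using D' converse_rtranclp_into_rtranclp by metis
  qed blast
qed

text \<open>Each deflation removes a line, so the choice in \<open>reduced\<close> succeeds; what is
  shown later about \<open>reduced\<close> rests on these two facts.\<close>

lemma reduced_deflations: "deflation\<^sup>*\<^sup>* D (reduced D)" "\<nexists>R. deflation (reduced D) R"
  using someI_ex[OF deflations_end[of D]] by (simp_all add: reduced_def)

text \<open>The line p is a leaf with label 0. Closing the gap at p by g, the inverse of
  \<open>lift_line\<close> away from p, exhibits the diagram as an inflation.\<close>

lemma deflation_at_leaf: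
  assumes fence: "is_fence (underlying (b, us @ (i, j, 0) # ws))"
    and p: "p = i \<or> p = j"
    and free: "\<And>k l e. (k, l, e) \<in> set us \<union> set ws \<Longrightarrow> k \<noteq> p \<and> l \<noteq> p"
  shows "\<exists>R. deflation (b, us @ (i, j, 0) # ws) R"
proof -
  define g where "g = (\<lambda>k. if k < p then k else k - 1)"
  define f where "f = (\<lambda>(k, l, e :: int). (g k, g l, e))"
  define q where "q = (if p = i then j else i)"
  have ij: "1 \<le> i" "i < j" "j \<le> b"
    using fence unfolding is_fence_underlying by auto
  have lift: "lift_line p (g k) = k" if "k \<noteq> p" for k
    using that by (auto simp: lift_line_def g_def)
  have lift_f: "map (lift_seg p) (map f xs) = xs" if "set xs \<subseteq> set us \<union> set ws" for xs
  proof -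
    have "lift_seg p (f v) = v" if "v \<in> set xs" for v
    proof (cases v)
      case (fields k l e)
      then have "k \<noteq> p" "l \<noteq> p"
        using that \<open>set xs \<subseteq> _\<close> free[of k l e] by auto
      then show ?thesis
        by (simp add: fields f_def lift)
    qed
    then show ?thesis
      by (simp add: map_idI)
  qed
  have q: "lift_line p (g q) = q"
    using ij p by (intro lift) (auto simp: q_def)
  have g: "1 \<le> g q" "g q \<le> b - 1"
    using ij p by (auto simp: g_def q_def split: if_splits)
  have "inflation (b - 1, map f us @ map f ws)
     (b - 1 + 1, map (lift_seg p) (map f us) @
       [(min p (lift_line p (g q)), max p (lift_line p (g q)), 0)] @
       map (lift_seg p) (map f ws))"
    using ij p g by (intro inflation.intros) auto
  moreover have "min p q = i" "max p q = j"
    using ij p by (auto simp: q_def)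
  ultimately have "inflation (b - 1, map f us @ map f ws) (b, us @ (i, j, 0) # ws)"
    using ij unfolding q by (simp add: lift_f del: map_map)
  then show ?thesis
    unfolding deflation_def by blast
qed

section \<open>Degree count for irreducible diagrams\<close>

lemma endpoints_subset: "endpoints vs k \<subseteq> {..<length vs}"
  by (auto simp: endpoints_def)

lemma finite_endpoints [simp]: "finite (endpoints vs k)"
  using endpoints_subset finite_subset by blast

lemma nth_segment: "vs ! m = (upper vs m, lower vs m, sdir vs m)"
  by (simp add: upper_def lower_def sdir_def)

lemma fence_segment:
  assumes "is_fence (underlying (b, vs))" "m < length vs"
  shows "1 \<le> upper vs m" "upper vs m < lower vs m" "lower vs m \<le> b"
  using assms nth_mem[OF assms(2)] unfolding is_fence_underlying nth_segment by auto

lemma sum_card_endpoints: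
  assumes "is_fence (underlying (b, vs))"
  shows "(\<Sum>k \<in> {1..b}. card (endpoints vs k)) = 2 * length vs"
proof -
  have "(\<Sum>k \<in> {1..b}. card (endpoints vs k)) =
      (\<Sum>k \<in> {1..b}. \<Sum>m < length vs. of_bool (upper vs m = k) + of_bool (lower vs m = k))"
  proof (rule sum.cong[OF refl])
    fix k
    have "(\<Sum>m < length vs. of_bool (upper vs m = k) + of_bool (lower vs m = k)) =
        (\<Sum>m < length vs. of_bool (upper vs m = k \<or> lower vs m = k) :: nat)"
    proof (rule sum.cong[OF refl])
      fix m assume "m \<in> {..<length vs}"
      then show "of_bool (upper vs m = k) + of_bool (lower vs m = k) =
          (of_bool (upper vs m = k \<or> lower vs m = k) :: nat)"
        using fence_segment(2)[OF assms, of m] by auto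
    qed
    also have "\<dots> = card (endpoints vs k)"
      by (simp add: endpoints_def of_bool_def flip: sum.inter_filter)
    finally show "card (endpoints vs k) =
        (\<Sum>m < length vs. of_bool (upper vs m = k) + of_bool (lower vs m = k))" ..
  qed
  also have "\<dots> = (\<Sum>m < length vs. \<Sum>k \<in> {1..b}. of_bool (upper vs m = k) + of_bool (lower vs m = k))"
    by (rule sum.swap)
  also have "\<dots> = (\<Sum>m < length vs. 2)"
  proof (rule sum.cong[OF refl])
    fix m assume "m \<in> {..<length vs}"
    then have "upper vs m \<in> {1..b}" "lower vs m \<in> {1..b}"
      using fence_segment[OF assms, of m] by auto
    then show "(\<Sum>k \<in> {1..b}. of_bool (upper vs m = k) + of_bool (lower vs m = k)) = (2::nat)"
      by (simp add: sum.distrib of_bool_def)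
  qed
  finally show ?thesis by simp
qed

lemma inflow_off_endpoints:
  "m < length vs \<Longrightarrow> m \<notin> endpoints vs k \<Longrightarrow> inflow k (vs ! m) = 0"
  by (simp add: nth_segment endpoints_def)

lemma inflow_endpoint:
  assumes "m \<in> endpoints vs k" shows "\<bar>inflow k (vs ! m)\<bar> = \<bar>sdir vs m\<bar>"
  using assms by (auto simp: nth_segment endpoints_def)

lemma sum_list_inflow: "(\<Sum>v \<leftarrow> vs. inflow k v) = (\<Sum>m \<in> endpoints vs k. inflow k (vs ! m))"
proof -
  have "(\<Sum>v \<leftarrow> vs. inflow k v) = (\<Sum>m < length vs. inflow k (vs ! m))"
    by (simp add: sum_list_sum_nth atLeast0LessThan)
  also have "\<dots> = (\<Sum>m \<in> endpoints vs k. inflow k (vs ! m))"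
    using endpoints_subset inflow_off_endpoints by (intro sum.mono_neutral_right) auto
  finally show ?thesis .
qed

text \<open>With several lines, connectedness excludes lines without ends, and a line with a single
  end could be deflated. So every line has at least two ends; as there are twice as many ends as
  segments, and at most b segments, every line has exactly two.\<close>

lemma irreducible_cases:
  assumes tight: "tight (underlying (b, vs))" and flow: "flow (b, vs)"
    and irred: "\<nexists>R. deflation (b, vs) R"
  shows "b = 1 \<and> vs = [] \<or> length vs = b \<and> (\<forall>k \<in> {1..b}. card (endpoints vs k) = 2)"
proof (cases "b = 1")
  case True
  have "vs = []"
    using tight True unfolding tight_def is_fence_underlying
    by (cases vs) (auto dest: less_le_trans)
  with True show ?thesis by simp
next
  case False
  have fence: "is_fence (underlying (b, vs))" and "length vs \<le> b"
    using tight by (auto simp: tight_def)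
  then have "2 \<le> b"
    using False unfolding is_fence_underlying by simp
  have ge: "2 \<le> card (endpoints vs k)" if k: "k \<in> {1..b}" for k
  proof -
    have "endpoints vs k \<noteq> {}"
    proof
      assume empty: "endpoints vs k = {}"
      have closed: "\<forall>(i, j, e) \<in> set vs. i \<in> {k} \<longleftrightarrow> j \<in> {k}"
      proof
        fix v assume "v \<in> set vs"
        then obtain m where "m < length vs" "v = vs ! m"
          by (auto simp: in_set_conv_nth)
        then show "case v of (i, j, e) \<Rightarrow> i \<in> {k} \<longleftrightarrow> j \<in> {k}"
          using empty by (auto simp: nth_segment endpoints_def)
      qed
      have "linked_by (set (snd (underlying (b, vs)))) {1..b}"
        using tight by (simp add: tight_def)
      then have "{1..b} \<subseteq> {k} \<or> {1..b} \<inter> {k} = {}"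
        using closed unfolding linked_by_underlying by blast
      then have "{1..b} \<subseteq> {k}"
        using k by blast
      then have "1 \<in> {k}" "2 \<in> {k}"
        using \<open>2 \<le> b\<close> by (auto simp: subset_iff)
      then show False by simp
    qed
    moreover have "card (endpoints vs k) \<noteq> 1"
    proof
      assume "card (endpoints vs k) = 1"
      then obtain m where m: "endpoints vs k = {m}"
        by (auto simp: card_1_singleton_iff)
      then have mn: "m < length vs"
        using endpoints_subset[of vs k] by auto
      \<comment> \<open>Balance at a line with a single end forces the label there to be 0, as a
        deflation requires.\<close>
      have "(\<Sum>v \<leftarrow> vs. inflow k v) = 0"
        using flow k unfolding flow_def by simp
      then have "inflow k (vs ! m) = 0"
        by (simp add: sum_list_inflow m)
      then have "sdir vs m = 0"
        using inflow_endpoint[of m vs k] m by simp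
      then have vs: "vs = take m vs @ (upper vs m, lower vs m, 0) # drop (Suc m) vs"
        using id_take_nth_drop[OF mn] nth_segment[of vs m] by simp
      have "\<exists>R. deflation (b, take m vs @ (upper vs m, lower vs m, 0) # drop (Suc m) vs) R"
      proof (rule deflation_at_leaf)
        show "is_fence (underlying (b, take m vs @ (upper vs m, lower vs m, 0) # drop (Suc m) vs))"
          using fence vs by simp
        have "m \<in> endpoints vs k"
          using m by simp
        then show "k = upper vs m \<or> k = lower vs m"
          by (auto simp: endpoints_def)
        fix i j e assume "(i, j, e) \<in> set (take m vs) \<union> set (drop (Suc m) vs)"
        then obtain r where r: "r < length vs" "vs ! r = (i, j, e)" "r \<noteq> m"
        proof
          assume "(i, j, e) \<in> set (take m vs)"
          then obtain r where "r < m" "vs ! r = (i, j, e)"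
            by (auto simp: in_set_conv_nth)
          with mn show thesis
            by (intro that[of r]) auto
        next
          assume "(i, j, e) \<in> set (drop (Suc m) vs)"
          then obtain r where "r < length vs - Suc m" "vs ! (Suc m + r) = (i, j, e)"
            by (auto simp: in_set_conv_nth)
          with mn show thesis
            by (intro that[of "Suc m + r"]) auto
        qed
        then have "r \<notin> endpoints vs k"
          using m by simp
        then show "i \<noteq> k \<and> j \<noteq> k"
          using r by (simp add: endpoints_def upper_def lower_def)
      qed
      then show False
        using irred vs by simp
    qed
    ultimately show ?thesis
      by (metis One_nat_def Suc_1 card_0_eq finite_endpoints less_2_cases not_less)
  qed
  have "(\<Sum>k \<in> {1..b}. card (endpoints vs k)) \<le> (\<Sum>k \<in> {1..b}. 2)"
    using sum_card_endpoints[OF fence] \<open>length vs \<le> b\<close> by simp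
  then have "\<not> (\<exists>k \<in> {1..b}. 2 < card (endpoints vs k))"
    using sum_strict_mono_ex1[of "{1..b}" "\<lambda>_. 2" "\<lambda>k. card (endpoints vs k)"] ge by fastforce
  then have two: "\<forall>k \<in> {1..b}. card (endpoints vs k) = 2"
    using ge by (simp add: le_antisym not_less)
  then have "length vs = b"
    using sum_card_endpoints[OF fence] by simp
  with two show ?thesis by simp
qed

text \<open>Lines and segments form closed curves here, but the labels may still be arbitrary
  balanced integers; this serves flows that are not yet known to be orientations.\<close>

locale closed_diagram =
  fixes b :: nat and vs :: "(nat \<times> nat \<times> int) list"
  assumes fence: "is_fence (underlying (b, vs))"
    and flow: "flow (b, vs)"
    and two_ends: "k \<in> {1..b} \<Longrightarrow> card (endpoints vs k) = 2"
begin

lemma ends: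
  assumes k: "k \<in> {1..b}"
  shows "endpoints vs k = {left_end vs k, right_end vs k}" "left_end vs k < right_end vs k"
    "right_end vs k < length vs"
proof -
  obtain p q where pq: "endpoints vs k = {p, q}" "p < q"
    using two_ends[OF k] unfolding card_2_iff by (metis insert_commute linorder_neqE_nat)
  then have "left_end vs k = p" "right_end vs k = q"
    by (simp_all add: left_end_def right_end_def)
  with pq show "endpoints vs k = {left_end vs k, right_end vs k}" "left_end vs k < right_end vs k"
    by auto
  then show "right_end vs k < length vs"
    using endpoints_subset[of vs k] by auto
qed

lemma hdir_eq: "k \<in> {1..b} \<Longrightarrow> hdir vs k = inflow k (vs ! left_end vs k)"
proof -
  assume "k \<in> {1..b}"
  then have "left_end vs k \<in> endpoints vs k"
    using ends by blast
  then show ?thesis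
    by (auto simp: nth_segment hdir_def endpoints_def Let_def)
qed

lemma inflow_nth:
  assumes k: "k \<in> {1..b}" and m: "m < length vs"
  shows "inflow k (vs ! m) =
    (if m = left_end vs k then hdir vs k else 0) - (if m = right_end vs k then hdir vs k else 0)"
proof -
  have "inflow k (vs ! left_end vs k) + inflow k (vs ! right_end vs k) = 0"
  proof -
    have "(\<Sum>v \<leftarrow> vs. inflow k v) = 0"
      using flow k by (simp add: flow_def)
    then show ?thesis
      using ends[OF k] by (simp add: sum_list_inflow)
  qed
  then show ?thesis
    using inflow_off_endpoints[OF m, of k] ends[OF k] hdir_eq[OF k] by auto
qed

text \<open>The inflow from the left of position m is what runs on the line k at m. The right end
  itself is included in the condition because only positions strictly before m are summed.\<close>

lemma sum_inflow_before:
  assumes "k \<in> {1..b}" "m \<le> length vs"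
  shows "(\<Sum>p < m. inflow k (vs ! p)) =
    (if left_end vs k < m \<and> m \<le> right_end vs k then hdir vs k else 0)"
proof -
  have "(\<Sum>p < m. inflow k (vs ! p)) = (\<Sum>p < m. (if p = left_end vs k then hdir vs k else 0) -
      (if p = right_end vs k then hdir vs k else 0))"
    using assms by (intro sum.cong inflow_nth) auto
  also have "\<dots> = (if left_end vs k < m then hdir vs k else 0) - (if right_end vs k < m then hdir vs k else 0)"
    by (simp only: sum_subtractf) simp
  finally show ?thesis
    using ends(2)[OF assms(1)] by auto
qed

lemma segment_lines:
  "m < length vs \<Longrightarrow> upper vs m \<in> {1..b}" "m < length vs \<Longrightarrow> lower vs m \<in> {1..b}"
  using fence_segment[OF fence, of m] by auto

text \<open>By balance the two ends of a line carry labels of equal absolute value. So no segment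
  leaves the set of lines with a given absolute value, and connectedness applies.\<close>

lemma constant_labels:
  assumes "linked_by (set (snd (underlying (b, vs)))) {1..b}" "m < length vs" "m' < length vs"
  shows "\<bar>sdir vs m\<bar> = \<bar>sdir vs m'\<bar>"
proof -
  have at: "\<bar>sdir vs p\<bar> = \<bar>hdir vs k\<bar>" if "k \<in> {1..b}" "p \<in> endpoints vs k" for p k
    using inflow_endpoint[OF that(2)] inflow_nth[OF that(1), of p] ends[OF that(1)] that(2)
    by (auto split: if_splits)
  let ?X = "{k. \<bar>hdir vs k\<bar> = \<bar>sdir vs m\<bar>}"
  have seg: "\<bar>hdir vs (upper vs p)\<bar> = \<bar>sdir vs p\<bar>" "\<bar>hdir vs (lower vs p)\<bar> = \<bar>sdir vs p\<bar>"
    if "p < length vs" for p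
    using at[of "upper vs p" p] at[of "lower vs p" p] segment_lines that
    by (auto simp: endpoints_def)
  have "\<forall>(i, j, e) \<in> set vs. i \<in> ?X \<longleftrightarrow> j \<in> ?X"
  proof
    fix v assume "v \<in> set vs"
    then obtain p where "p < length vs" "v = vs ! p"
      by (auto simp: in_set_conv_nth)
    then show "case v of (i, j, e) \<Rightarrow> i \<in> ?X \<longleftrightarrow> j \<in> ?X"
      using seg by (simp add: nth_segment)
  qed
  then have "{1..b} \<subseteq> ?X \<or> {1..b} \<inter> ?X = {}"
    using assms(1)[unfolded linked_by_underlying] by blast
  moreover have "upper vs m \<in> {1..b} \<inter> ?X" "upper vs m' \<in> {1..b}"
    using segment_lines seg assms(2,3) by auto
  ultimately have "upper vs m' \<in> ?X"
    by blast
  then show ?thesis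
    using seg assms(3) by simp
qed

lemma cyclic:
  assumes "\<And>m. m < length vs \<Longrightarrow> sdir vs m \<noteq> 0"
  shows "cyclic (b, vs)"
proof -
  have "length (filter (\<lambda>x. x \<noteq> 0) (map (inflow k) vs)) \<le> 2" if "k \<in> {1..b}" for k
  proof -
    have "length (filter (\<lambda>x. x \<noteq> 0) (map (inflow k) vs)) = card {m. m < length vs \<and> inflow k (vs ! m) \<noteq> 0}"
      by (simp add: length_filter_conv_card cong: conj_cong)
    also have "\<dots> \<le> card (endpoints vs k)"
      using inflow_off_endpoints by (intro card_mono) auto
    finally show ?thesis
      using two_ends[OF that] by simp
  qed
  moreover have "e \<noteq> 0" if "(i, j, e) \<in> set vs" for i j e
  proof -
    obtain m where "m < length vs" "vs ! m = (i, j, e)"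
      using \<open>(i, j, e) \<in> set vs\<close> by (auto simp: in_set_conv_nth)
    then show ?thesis
      using assms[of m] by (simp add: sdir_def)
  qed
  ultimately show ?thesis
    unfolding cyclic_def by auto
qed

end

section \<open>Crossings and cusps of an oriented closed curve\<close>

lemma sum_unit_signs:
  fixes s :: "'a \<Rightarrow> int"
  assumes "finite A" "\<And>x. x \<in> A \<Longrightarrow> s x = 1 \<or> s x = -1"
  shows "(\<Sum>x \<in> A. s x) = int (card {x \<in> A. s x = 1}) - int (card {x \<in> A. s x = -1})"
proof -
  have "(\<Sum>x \<in> A. s x) = (\<Sum>x \<in> A. of_bool (s x = 1) - of_bool (s x = -1))"
    using assms(2) by (intro sum.cong) auto
  then show ?thesis
    using assms(1) by (simp add: sum_subtractf Int_def)
qed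

lemma linking_nth: "linking vs = (\<Sum>m < length vs. \<Sum>p < m. pairing (vs ! p) (vs ! m))"
proof (induction vs rule: rev_induct)
  case (snoc v vs)
  have "(\<Sum>u \<leftarrow> vs. pairing u v) = (\<Sum>p < length vs. pairing (vs ! p) v)"
    by (simp add: sum_list_sum_nth atLeast0LessThan)
  then show ?case
    using snoc by (simp add: linking_append nth_append)
qed simp

lemma first_nonzero_nth:
  "p < length xs \<Longrightarrow> xs ! p \<noteq> 0 \<Longrightarrow> (\<And>m. m < p \<Longrightarrow> xs ! m = 0) \<Longrightarrow> first_nonzero xs = xs ! p"
proof (induction xs arbitrary: p)
  case (Cons x xs)
  show ?case
  proof (cases p)
    case 0
    then show ?thesis using Cons.prems by simp
  next
    case (Suc r)
    have "x = 0"
      using Cons.prems(3)[of 0] Suc by simp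
    moreover have "first_nonzero xs = xs ! r"
      using Cons.prems(1,2) Cons.prems(3)[of "Suc _"] Suc by (intro Cons.IH) auto
    ultimately show ?thesis
      using Suc by simp
  qed
qed simp

locale oriented_diagram = closed_diagram +
  assumes unit: "m < length vs \<Longrightarrow> sdir vs m = 1 \<or> sdir vs m = -1"
begin

lemma hdir_unit:
  assumes "k \<in> {1..b}" shows "hdir vs k = 1 \<or> hdir vs k = -1"
proof -
  have "left_end vs k \<in> endpoints vs k" "left_end vs k < length vs"
    using ends[OF assms] by auto
  then show ?thesis
    using inflow_endpoint[of "left_end vs k" vs k] unit[of "left_end vs k"] hdir_eq[OF assms] by auto
qed

text \<open>Summed over its predecessors, the pairing with a fixed segment m counts the signed
  crossings on m, minus 1 if m ends in a right cusp.\<close>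

lemma front_tb_eq_linking: "front_tb vs = linking vs"
proof -
  let ?n = "length vs"
  let ?C = "\<lambda>m. {k \<in> {upper vs m<..<lower vs m}. left_end vs k < m \<and> m < right_end vs k}"
  have per_segment: "(\<Sum>p < m. pairing (vs ! p) (vs ! m)) =
      (\<Sum>k \<in> ?C m. sdir vs m * hdir vs k) - of_bool (m = right_end vs (lower vs m))"
    if m: "m < ?n" for m
  proof -
    let ?l = "lower vs m" and ?u = "upper vs m"
    have lines: "k \<in> {1..b}" if "k \<in> {?u<..?l}" for k
      using that fence_segment[OF fence m] by auto
    have "(\<Sum>p < m. pairing (vs ! p) (vs ! m)) = (\<Sum>p < m. sdir vs m * (\<Sum>k \<in> {?u<..?l}. inflow k (vs ! p)))"
    proof (rule sum.cong[OF refl])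
      fix p assume "p \<in> {..<m}"
      then have "fst (vs ! p) \<noteq> fst (snd (vs ! p))"
        using m fence_segment(2)[OF fence, of p] by (simp add: nth_segment)
      then show "pairing (vs ! p) (vs ! m) = sdir vs m * (\<Sum>k \<in> {?u<..?l}. inflow k (vs ! p))"
        by (subst nth_segment[of vs m]) (rule pairing_eq_sum_inflow)
    qed
    also have "\<dots> = sdir vs m * (\<Sum>k \<in> {?u<..?l}. \<Sum>p < m. inflow k (vs ! p))"
      by (simp only: sum.swap[of _ "{..<m}"] flip: sum_distrib_left)
    also have "\<dots> = sdir vs m * (\<Sum>k \<in> {?u<..?l}. if left_end vs k < m \<and> m \<le> right_end vs k then hdir vs k else 0)"
      using lines sum_inflow_before m by simp
    also have "{?u<..?l} = insert ?l {?u<..<?l}"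
      using fence_segment[OF fence m] by auto
    also have "(\<Sum>k \<in> insert ?l {?u<..<?l}. if left_end vs k < m \<and> m \<le> right_end vs k then hdir vs k else 0) =
      (if left_end vs ?l < m \<and> m \<le> right_end vs ?l then hdir vs ?l else 0) +
      (\<Sum>k \<in> {?u<..<?l}. if left_end vs k < m \<and> m \<le> right_end vs k then hdir vs k else 0)"
      by simp
    \<comment> \<open>On a line strictly between its ends, m is not an endpoint, so the boundary
      case m = \<open>right_end vs k\<close> cannot occur and genuine crossings remain.\<close>
    also have "(\<Sum>k \<in> {?u<..<?l}. if left_end vs k < m \<and> m \<le> right_end vs k then hdir vs k else 0) =
        (\<Sum>k \<in> {?u<..<?l}. if left_end vs k < m \<and> m < right_end vs k then hdir vs k else 0)"
    proof (rule sum.cong[OF refl])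
      fix k assume k: "k \<in> {?u<..<?l}"
      then have "m \<notin> endpoints vs k"
        by (auto simp: endpoints_def)
      then have "m \<noteq> right_end vs k"
        using ends(1)[of k] k lines by auto
      then show "(if left_end vs k < m \<and> m \<le> right_end vs k then hdir vs k else 0) =
          (if left_end vs k < m \<and> m < right_end vs k then hdir vs k else 0)"
        by auto
    qed
    also have "\<dots> = (\<Sum>k \<in> ?C m. hdir vs k)"
      by (simp only: sum.inter_filter[OF finite_greaterThanLessThan])
    \<comment> \<open>At the lower line: if m is its left end, the condition fails; if m is its
      right end, balance makes the direction on the line opposite to that of m, and the product is
      -1, the cusp term.\<close>
    also have "sdir vs m * ((if left_end vs ?l < m \<and> m \<le> right_end vs ?l then hdir vs ?l else 0) +
        (\<Sum>k \<in> ?C m. hdir vs k)) = (\<Sum>k \<in> ?C m. sdir vs m * hdir vs k) - of_bool (m = right_end vs ?l)"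
    proof -
      have l: "?l \<in> {1..b}"
        using segment_lines(2)[OF m] .
      have "m \<in> endpoints vs ?l"
        using m by (simp add: endpoints_def)
      then have "m = left_end vs ?l \<or> m = right_end vs ?l"
        using ends(1)[OF l] by blast
      moreover have "inflow ?l (vs ! m) = sdir vs m"
        by (simp add: nth_segment)
      ultimately have "sdir vs m * (if left_end vs ?l < m \<and> m \<le> right_end vs ?l then hdir vs ?l else 0) =
          - of_bool (m = right_end vs ?l)"
        using inflow_nth[OF l m] ends(2)[OF l] hdir_unit[OF l] by auto
      then show ?thesis
        by (simp add: distrib_left sum_distrib_left)
    qed
    finally show ?thesis .
  qed
  have crossings: "crossings vs = Sigma {..<?n} ?C"
    by (auto simp: crossings_def)
  have "(\<Sum>c \<in> crossings vs. crossing_sign vs c) =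
      int (card {c \<in> crossings vs. crossing_sign vs c = 1}) -
      int (card {c \<in> crossings vs. crossing_sign vs c = -1})"
  proof (rule sum_unit_signs)
    show "finite (crossings vs)"
      unfolding crossings by auto
    fix c assume "c \<in> crossings vs"
    then obtain m k where c: "c = (m, k)" "m < ?n" "upper vs m < k" "k < lower vs m"
      by (auto simp: crossings_def)
    then have "k \<in> {1..b}"
      using fence_segment[OF fence c(2)] by auto
    then show "crossing_sign vs c = 1 \<or> crossing_sign vs c = -1"
      using unit[OF c(2)] hdir_unit[of k] unfolding crossing_sign_def c(1) by fastforce
  qed
  moreover have "(\<Sum>c \<in> crossings vs. crossing_sign vs c) = (\<Sum>m < ?n. \<Sum>k \<in> ?C m. sdir vs m * hdir vs k)"
    unfolding crossings crossing_sign_def by (rule sum.Sigma[symmetric]) auto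
  moreover have "int (card (right_cusps vs)) = (\<Sum>m < ?n. of_bool (m = right_end vs (lower vs m)))"
  proof -
    have "right_cusps vs = {m \<in> {..<?n}. m = right_end vs (lower vs m)}"
      by (auto simp: right_cusps_def)
    then show ?thesis
      by (simp add: of_bool_def sum.If_cases Int_def)
  qed
  ultimately show ?thesis
    by (simp add: front_tb_def linking_nth per_segment sum_subtractf)
qed

text \<open>A right cusp is a lower end that is not the left end of its line. Hence the cusps sum to
  all labels, minus those at lower ends that are left ends, plus those at upper ends that are left
  ends; these corrections are minus the directions of the lines.\<close>

lemma cusps_eq_rotation: "int (down_cusps vs) - int (up_cusps vs) = rotation (b, vs)"
proof -
  let ?n = "length vs"
  have signs: "(\<Sum>m \<in> A. sdir vs m) = int (card {m \<in> A. sdir vs m = 1}) - int (card {m \<in> A. sdir vs m = -1})"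
    if "A \<subseteq> {..<?n}" for A
    using that unit finite_subset by (intro sum_unit_signs) auto
  have L: "(\<Sum>m \<in> left_cusps vs. sdir vs m) = (\<Sum>m < ?n. if m = left_end vs (upper vs m) then sdir vs m else 0)"
    unfolding left_cusps_def by (subst sum.inter_filter[symmetric]) (auto intro!: sum.cong)
  have "(\<Sum>m \<in> right_cusps vs. sdir vs m) = (\<Sum>m < ?n. if m = right_end vs (lower vs m) then sdir vs m else 0)"
    unfolding right_cusps_def by (subst sum.inter_filter[symmetric]) (auto intro!: sum.cong)
  also have "\<dots> = (\<Sum>m < ?n. sdir vs m - (if m = left_end vs (lower vs m) then sdir vs m else 0))"
  proof (rule sum.cong[OF refl])
    fix m assume "m \<in> {..<?n}"
    then have "m \<in> endpoints vs (lower vs m)" "lower vs m \<in> {1..b}"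
      using segment_lines by (auto simp: endpoints_def)
    then show "(if m = right_end vs (lower vs m) then sdir vs m else 0) =
        sdir vs m - (if m = left_end vs (lower vs m) then sdir vs m else 0)"
      using ends(1,2)[of "lower vs m"] by auto
  qed
  finally have R: "(\<Sum>m \<in> right_cusps vs. sdir vs m) = \<dots>" .
  have "(\<Sum>k \<in> {1..b}. hdir vs k) = (\<Sum>k \<in> {1..b}. \<Sum>m < ?n. if m = left_end vs k then inflow k (vs ! m) else 0)"
  proof (rule sum.cong[OF refl])
    fix k assume k: "k \<in> {1..b}"
    then show "hdir vs k = (\<Sum>m < ?n. if m = left_end vs k then inflow k (vs ! m) else 0)"
      using hdir_eq[OF k] ends[OF k] by (simp del: inflow_simps)
  qed
  also have "\<dots> = (\<Sum>m < ?n. \<Sum>k \<in> {1..b}. if m = left_end vs k then inflow k (vs ! m) else 0)"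
    by (rule sum.swap)
  also have "\<dots> = (\<Sum>m < ?n. (if m = left_end vs (lower vs m) then sdir vs m else 0) -
      (if m = left_end vs (upper vs m) then sdir vs m else 0))"
  proof (rule sum.cong[OF refl])
    fix m assume m: "m \<in> {..<?n}"
    have "(\<Sum>k \<in> {1..b}. if m = left_end vs k then inflow k (vs ! m) else 0) =
        (\<Sum>k \<in> {upper vs m, lower vs m}. if m = left_end vs k then inflow k (vs ! m) else 0)"
      using m segment_lines by (intro sum.mono_neutral_right) (auto simp: nth_segment)
    also have "\<dots> = (if m = left_end vs (lower vs m) then sdir vs m else 0) -
      (if m = left_end vs (upper vs m) then sdir vs m else 0)"
      using m fence_segment(2)[OF fence, of m] by (simp add: nth_segment)
    finally show "(\<Sum>k \<in> {1..b}. if m = left_end vs k then inflow k (vs ! m) else 0) = \<dots>" .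
  qed
  finally have H: "(\<Sum>k \<in> {1..b}. hdir vs k) = \<dots>" .
  have "first_nonzero (map (inflow k) vs) = hdir vs k" if k: "k \<in> {1..b}" for k
  proof -
    have "first_nonzero (map (inflow k) vs) = map (inflow k) vs ! left_end vs k"
    proof (rule first_nonzero_nth)
      show "left_end vs k < length (map (inflow k) vs)"
        using ends[OF k] by simp
      then show "map (inflow k) vs ! left_end vs k \<noteq> 0"
        using hdir_unit[OF k] hdir_eq[OF k] by auto
      show "map (inflow k) vs ! m = 0" if "m < left_end vs k" for m
        using that ends[OF k] inflow_nth[OF k, of m] by simp
    qed
    then show ?thesis
      using hdir_eq[OF k] ends[OF k] by simp
  qed
  moreover have "(\<Sum>(i, j, e) \<leftarrow> vs. e) = (\<Sum>m < ?n. sdir vs m)"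
    by (simp add: sum_list_sum_nth atLeast0LessThan nth_segment)
  ultimately have "rotation (b, vs) = (\<Sum>m < ?n. sdir vs m) - (\<Sum>k \<in> {1..b}. hdir vs k)"
    by (simp add: rotation_def)
  also have "\<dots> = (\<Sum>m \<in> left_cusps vs. sdir vs m) + (\<Sum>m \<in> right_cusps vs. sdir vs m)"
    unfolding L R H by (simp add: sum_subtractf)
  also have "\<dots> = int (down_cusps vs) - int (up_cusps vs)"
    by (subst (1 2) signs) (auto simp: left_cusps_def right_cusps_def down_cusps_def up_cusps_def)
  finally show ?thesis ..
qed

end

subsection \<open>Orientations as primitive flows\<close>

lemma oriented_iff_reduced:
  "oriented D \<longleftrightarrow> flow (reduced D) \<and> (\<forall>(i, j, e) \<in> set (snd (reduced D)). e = 1 \<or> e = -1)"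
  by (cases "reduced D") (auto simp: oriented_def flow_def inflow_def)

text \<open>A tree deflates to a single line and a diagram with one cycle to a closed curve.
  Deflations preserve lines minus segments, so the original diagram already tells the cases
  apart.\<close>

lemma reduced_cases:
  assumes "tight (underlying D)" "flow D"
  obtains "reduced D = (1, [])" "length (snd D) < fst D"
    | b vs where "reduced D = (b, vs)" "closed_diagram b vs" "length (snd D) = fst D" "vs \<noteq> []"
proof -
  obtain b vs where R: "reduced D = (b, vs)" by fastforce
  have "is_fence (underlying D)"
    using assms(1) by (simp add: tight_def)
  note inv = deflations_invariant[OF reduced_deflations(1) this, unfolded R]
  then have fence: "is_fence (underlying (b, vs))"
    by blast
  have "b = 1 \<and> vs = [] \<or> length vs = b \<and> (\<forall>k \<in> {1..b}. card (endpoints vs k) = 2)"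
    using irreducible_cases inv assms reduced_deflations(2)[of D] R by metis
  then show thesis
  proof (elim disjE conjE)
    assume "b = 1" "vs = []"
    moreover have "length (snd D) \<noteq> fst D"
      using inv calculation by simp
    ultimately show thesis
      using that(1) R assms(1) by (simp add: tight_def)
  next
    assume len: "length vs = b" and two: "\<forall>k \<in> {1..b}. card (endpoints vs k) = 2"
    have "closed_diagram b vs"
      using inv assms two by unfold_locales auto
    moreover have "vs \<noteq> []"
      using fence len by (auto simp: is_fence_def)
    ultimately show thesis
      using that(2) R inv len by simp
  qed
qed

text \<open>Removes the reduction from the notion of orientation: on the reduced cycle all labels
  have the same absolute value, which is 1 exactly for primitive flows.\<close>

theorem oriented_iff_primitive_flow:
  assumes "tight (underlying D)"
  shows "oriented D \<longleftrightarrow> flow D \<and> (length (snd D) = fst D \<longrightarrow> primitive D)"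
proof -
  obtain b vs where R: "reduced D = (b, vs)" by fastforce
  have "is_fence (underlying D)"
    using assms by (simp add: tight_def)
  note inv = deflations_invariant[OF reduced_deflations(1) this, unfolded R]
  show ?thesis
  proof (cases "flow D")
    case True
    with assms show ?thesis
    proof (cases rule: reduced_cases)
      case 1
      then show ?thesis
        using True by (simp add: oriented_iff_reduced flow_def)
    next
      case (2 b' vs')
      then have "b' = b" "vs' = vs"
        using R by simp_all
      interpret closed_diagram b vs
        using 2 R by simp
      have vs: "vs \<noteq> []"
        using 2 R by simp
      have tight: "tight (underlying (b, vs))"
        using inv assms by simp
      have labels: "\<bar>e\<bar> = \<bar>sdir vs 0\<bar>" if "(i, j, e) \<in> set vs" for i j e
      proof -
        obtain m where "m < length vs" "vs ! m = (i, j, e)"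
          using \<open>(i, j, e) \<in> set vs\<close> by (auto simp: in_set_conv_nth)
        then show ?thesis
          using constant_labels[of m 0] tight vs by (simp add: tight_def sdir_def)
      qed
      have first: "(upper vs 0, lower vs 0, sdir vs 0) \<in> set vs"
        using vs nth_segment[of vs 0] by (metis length_greater_0_conv nth_mem)
      have "oriented D \<longleftrightarrow> (\<forall>(i, j, e) \<in> set vs. e = 1 \<or> e = -1)"
        using True inv by (simp add: oriented_iff_reduced R)
      also have "\<dots> \<longleftrightarrow> \<bar>sdir vs 0\<bar> = 1"
      proof
        assume "\<forall>(i, j, e) \<in> set vs. e = 1 \<or> e = -1"
        then show "\<bar>sdir vs 0\<bar> = 1"
          using first by fastforce
      next
        assume "\<bar>sdir vs 0\<bar> = 1"
        then have "\<bar>e\<bar> = 1" if "(i, j, e) \<in> set vs" for i j e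
          using labels[OF that] by simp
        then have "e = 1 \<or> e = -1" if "(i, j, e) \<in> set vs" for i j e
          using that by (metis abs_eq_iff' abs_1 zero_le_one)
        then show "\<forall>(i, j, e) \<in> set vs. e = 1 \<or> e = -1"
          by blast
      qed
      also have "\<dots> \<longleftrightarrow> primitive (b, vs)"
      proof
        assume unit: "\<bar>sdir vs 0\<bar> = 1"
        show "primitive (b, vs)"
          unfolding primitive_def
        proof (intro allI impI)
          fix d assume "\<forall>(i, j, e) \<in> set (snd (b, vs)). d dvd e"
          then have "d dvd \<bar>sdir vs 0\<bar>"
            using first by fastforce
          then show "is_unit d"
            by (simp only: unit)
        qed
      next
        assume "primitive (b, vs)"
        moreover have "\<forall>(i, j, e) \<in> set vs. sdir vs 0 dvd e"
          using labels by (auto simp: dvd_if_abs_eq)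
        ultimately have "is_unit (sdir vs 0)"
          by (simp add: primitive_def)
        then show "\<bar>sdir vs 0\<bar> = 1"
          by simp
      qed
      finally show ?thesis
        using True 2 inv by simp
    qed
  qed (use inv in \<open>simp add: oriented_iff_reduced R\<close>)
qed

theorem reduced_front:
  assumes "tight (underlying D)" "oriented D"
  shows "cyclic D" "front_tb (snd (reduced D)) = linking (snd D)"
    "fence_rot D = of_int (rotation D) / 2"
proof -
  obtain b vs where R: "reduced D = (b, vs)" by fastforce
  have "is_fence (underlying D)"
    using assms by (simp add: tight_def)
  note inv = deflations_invariant[OF reduced_deflations(1) this, unfolded R]
  have "flow D"
    using assms oriented_iff_primitive_flow by blast
  with assms(1) have "cyclic (b, vs) \<and> front_tb vs = linking vs \<and>
    int (down_cusps vs) - int (up_cusps vs) = rotation (b, vs)"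
  proof (cases rule: reduced_cases)
    case 1
    then have "b = 1" "vs = []"
      using R by simp_all
    then show ?thesis
      by (simp add: cyclic_def front_tb_def crossings_def right_cusps_def left_cusps_def
          down_cusps_def up_cusps_def rotation_def)
  next
    case (2 b' vs')
    then interpret closed_diagram b vs
      using R by simp
    interpret oriented_diagram b vs
    proof
      fix m assume "m < length vs"
      then have "(upper vs m, lower vs m, sdir vs m) \<in> set vs"
        using nth_segment[of vs m] by (metis nth_mem)
      then show "sdir vs m = 1 \<or> sdir vs m = -1"
        using assms(2) by (auto simp: oriented_iff_reduced R)
    qed
    have "cyclic (b, vs)"
      using unit by (intro cyclic) fastforce
    then show ?thesis
      using front_tb_eq_linking cusps_eq_rotation by simp
  qed
  moreover have "fence_rot D = of_int (int (down_cusps vs) - int (up_cusps vs)) / 2"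
    by (simp add: fence_rot_def front_rot_def R)
  ultimately show "cyclic D" "front_tb (snd (reduced D)) = linking (snd D)"
    "fence_rot D = of_int (rotation D) / 2"
    using inv by (simp_all add: R)
qed

lemma deflations_labels:
  assumes "deflation\<^sup>*\<^sup>* D R" "(i, j, e) \<in> set (snd D)"
  shows "e = 0 \<or> (\<exists>k l. (k, l, e) \<in> set (snd R))"
  using assms
proof (induction arbitrary: i j rule: converse_rtranclp_induct)
  case (step D D')
  have "inflation D' D"
    using step.hyps(1) by (simp add: deflation_def)
  then have "e = 0 \<or> (\<exists>k l. (k, l, e) \<in> set (snd D'))"
    using step.prems by cases (auto simp: lift_seg_def)
  then show ?case
    using step.IH by blast
qed auto

text \<open>Reflects that the group of flows has rank at most one: all nonzero labels have the same
  absolute value, and they occur only if there is a cycle.\<close>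

lemma flow_labels:
  assumes "tight (underlying D)" "flow D"
  shows "\<exists>d. \<forall>(i, j, e) \<in> set (snd D). e = 0 \<or> \<bar>e\<bar> = d \<and> length (snd D) = fst D"
proof -
  obtain b vs where R: "reduced D = (b, vs)" by fastforce
  have "is_fence (underlying D)"
    using assms by (simp add: tight_def)
  note inv = deflations_invariant[OF reduced_deflations(1) this, unfolded R]
  have labels: "e = 0 \<or> (\<exists>k l. (k, l, e) \<in> set vs)" if "(i, j, e) \<in> set (snd D)" for i j e
    using deflations_labels[OF reduced_deflations(1) that] R by simp
  from assms show ?thesis
  proof (cases rule: reduced_cases)
    case 1
    then show ?thesis
      using labels R by fastforce
  next
    case (2 b' vs')
    then interpret closed_diagram b vs
      using R by simp
    have "tight (underlying (b, vs))"
      using inv assms(1) by blast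
    then have "linked_by (set (snd (underlying (b, vs)))) {1..b}"
      by (simp add: tight_def)
    then have "\<bar>e\<bar> = \<bar>sdir vs 0\<bar>" if "(k, l, e) \<in> set vs" for k l e
    proof -
      obtain m where "m < length vs" "vs ! m = (k, l, e)"
        using \<open>(k, l, e) \<in> set vs\<close> by (auto simp: in_set_conv_nth)
      moreover from this have "0 < length vs"
        by linarith
      ultimately show ?thesis
        using constant_labels[of m 0] \<open>linked_by _ _\<close> by (simp add: sdir_def)
    qed
    then show ?thesis
      using labels 2 by (intro exI[of _ "\<bar>sdir vs 0\<bar>"]) blast
  qed
qed

subsection \<open>Orientations of a fence diagram differ by a sign\<close>

lemma linking_reverse: "linking (snd (reverse D)) = linking (snd D)"
  unfolding reverse_def snd_conv by (rule linking_map) (auto simp: pairing_def)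

lemma sum_list_inflow_reverse:
  "(\<Sum>v \<leftarrow> snd (reverse D). inflow k v) = - (\<Sum>v \<leftarrow> snd D. inflow k v)"
proof -
  have "(\<Sum>v \<leftarrow> map (\<lambda>(i, j, e). (i, j, - e)) vs. inflow k v) = - (\<Sum>v \<leftarrow> vs. inflow k v)" for vs
    by (induction vs) auto
  then show ?thesis
    by (simp only: reverse_def snd_conv)
qed

lemma underlying_reverse: "underlying (reverse D) = underlying D"
  by (simp add: reverse_def underlying_def case_prod_unfold o_def)

lemma oriented_reverse:
  assumes "tight (underlying D)" "oriented D"
  shows "oriented (reverse D)" "rotation (reverse D) = - rotation D"
proof -
  have "flow (reverse D) \<longleftrightarrow> flow D"
    unfolding flow_def sum_list_inflow_reverse by (simp add: reverse_def)
  moreover have "primitive (reverse D) \<longleftrightarrow> primitive D"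
    by (simp add: primitive_def reverse_def case_prod_unfold)
  ultimately show "oriented (reverse D)"
    using assms by (simp add: oriented_iff_primitive_flow underlying_reverse) (simp add: reverse_def)
  have "map (inflow k) (snd (reverse D)) = map uminus (map (inflow k) (snd D))" for k
    by (auto simp: reverse_def)
  moreover have "(\<Sum>(i, j, e) \<leftarrow> snd (reverse D). e) = - (\<Sum>(i, j, e) \<leftarrow> snd D. e)"
    by (simp add: reverse_def case_prod_unfold o_def uminus_sum_list_map)
  ultimately show "rotation (reverse D) = - rotation D"
    by (simp add: rotation_def first_nonzero_uminus sum_negf reverse_def del: map_map)
qed

text \<open>Apply \<open>flow_labels\<close> to a combination of the two orientations in which their
  relative sign at each segment shows up in the absolute value.\<close>

lemma oriented_unique:
  assumes tight: "tight (underlying D)" and same: "underlying D' = underlying D"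
    and or: "oriented D" "oriented D'"
  shows "D' = D \<or> D' = reverse D"
proof -
  let ?n = "length (snd D)"
  obtain b xs ys where D: "D = (b, xs)" "D' = (b, ys)"
    using same by (metis fst_underlying prod.collapse)
  have len: "length ys = length xs"
    using same length_underlying[of D] length_underlying[of D'] D by (metis snd_conv)
  have ends: "fst (ys ! m) = fst (xs ! m) \<and> fst (snd (ys ! m)) = fst (snd (xs ! m))" if "m < length xs" for m
  proof -
    have "map ends ys ! m = map ends xs ! m"
      using same D by simp
    then show ?thesis
      using that len by (simp add: ends_def case_prod_unfold)
  qed
  have y: "ys ! m = (upper xs m, lower xs m, sdir ys m)" if "m < length xs" for m
    using ends[OF that] by (simp add: upper_def lower_def sdir_def prod_eq_iff)
  have unit: "sdir zs m = 0 \<or> sdir zs m = 1 \<or> sdir zs m = -1"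
    if "oriented (b, zs)" "m < length zs" for zs m
  proof -
    have "(upper zs m, lower zs m, sdir zs m) \<in> set (snd (b, zs))"
      using that(2) nth_segment[of zs m] by (metis nth_mem snd_conv)
    then show ?thesis
      using deflations_labels[OF reduced_deflations(1)] that(1) unfolding oriented_iff_reduced by blast
  qed
  have tight': "tight (underlying D')"
    using tight same by simp
  have flows: "flow (b, xs)" "flow (b, ys)"
    using or tight tight' oriented_iff_primitive_flow D by blast+
  have nonzero: "\<exists>m < length zs. sdir zs m \<noteq> 0" if "primitive (b, zs)" for zs
  proof (rule ccontr)
    assume "\<not> ?thesis"
    then have "snd (snd v) = 0" if "v \<in> set zs" for v
      using that by (auto simp: in_set_conv_nth sdir_def)
    then have "\<forall>(i, j, e) \<in> set zs. 2 dvd e"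
      by fastforce
    then have "is_unit (2::int)"
      using \<open>primitive (b, zs)\<close>[unfolded primitive_def, rule_format, of 2] by simp
    then show False by simp
  qed
  have nontrivial: "(\<exists>m < length xs. sdir xs m \<noteq> 0) \<and> (\<exists>m < length xs. sdir ys m \<noteq> 0)"
    if "length xs = b"
  proof -
    have "primitive (b, xs)"
      using or(1) oriented_iff_primitive_flow[OF tight] D that by simp
    moreover have "primitive (b, ys)"
      using or(2) oriented_iff_primitive_flow[OF tight'] D that len by simp
    ultimately show ?thesis
      using nonzero[of xs] nonzero[of ys] len by simp
  qed
  \<comment> \<open>For x and y in {-1, 0, 1}, the absolute value of x + 3 * y is 4 for equal signs,
    2 for opposite signs, 1 or 3 if just one of them vanishes, and 0 only if both do. The weight 3
    makes these cases distinct.\<close>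
  define zs where "zs = map (\<lambda>m. (upper xs m, lower xs m, sdir xs m + 3 * sdir ys m)) [0..<length xs]"
  have lenz: "length zs = length xs"
    by (simp add: zs_def)
  have z: "zs ! m = (upper xs m, lower xs m, sdir xs m + 3 * sdir ys m)" if "m < length xs" for m
    using that by (simp add: zs_def)
  have "map ends zs = map ends xs"
    by (rule nth_equalityI) (simp_all add: lenz z nth_segment[of xs])
  then have "underlying (b, zs) = underlying D"
    by (simp add: D)
  moreover have "flow (b, zs)"
  proof -
    have "inflow k (zs ! m) = inflow k (xs ! m) + 3 * inflow k (ys ! m)" if "m < length xs" for k m
      using that by (simp add: z y) (simp add: nth_segment)
    then have "(\<Sum>v \<leftarrow> zs. inflow k v) = (\<Sum>v \<leftarrow> xs. inflow k v) + 3 * (\<Sum>v \<leftarrow> ys. inflow k v)" for k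
      by (simp add: sum_list_sum_nth lenz len sum.distrib sum_distrib_left)
    then show ?thesis
      using flows by (simp add: flow_def)
  qed
  ultimately obtain d where d: "\<forall>(i, j, e) \<in> set zs. e = 0 \<or> \<bar>e\<bar> = d \<and> length zs = b"
    using flow_labels[of "(b, zs)"] tight by auto
  have comb: "sdir xs m + 3 * sdir ys m = 0 \<or> \<bar>sdir xs m + 3 * sdir ys m\<bar> = d \<and> length xs = b"
    if "m < length xs" for m
  proof -
    have "(upper xs m, lower xs m, sdir xs m + 3 * sdir ys m) \<in> set zs"
      using nth_mem[of m zs] z[OF that] that lenz by simp
    then show ?thesis
      using d lenz by auto
  qed
  have cases: "(sdir xs m = 0 \<or> sdir xs m = 1 \<or> sdir xs m = -1) \<and> (sdir ys m = 0 \<or> sdir ys m = 1 \<or> sdir ys m = -1)"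
    if "m < length xs" for m
    using unit[of xs m] unit[of ys m] or that unfolding D len by blast
  have "(\<forall>m < length xs. sdir ys m = sdir xs m) \<or> (\<forall>m < length xs. sdir ys m = - sdir xs m)"
  proof (cases "length xs = b")
    case True
    then obtain m m' where m: "m < length xs" "sdir xs m \<noteq> 0" and m': "m' < length xs" "sdir ys m' \<noteq> 0"
      using nontrivial by blast
    \<comment> \<open>A nonzero x excludes d = 3 and a nonzero y excludes d = 1, so one relative
      sign holds at all segments of the cycle.\<close>
    have "d = 1 \<or> d = 2 \<or> d = 4"
      using cases[OF m(1)] comb[OF m(1)] m(2) by auto
    moreover have "d = 2 \<or> d = 3 \<or> d = 4"
      using cases[OF m'(1)] comb[OF m'(1)] m'(2) by auto
    ultimately consider "d = 2" | "d = 4" by auto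
    then show ?thesis
    proof cases
      case 1
      have "sdir ys m = - sdir xs m" if "m < length xs" for m
        using cases[OF that] comb[OF that] 1 by auto
      then show ?thesis by blast
    next
      case 2
      have "sdir ys m = sdir xs m" if "m < length xs" for m
        using cases[OF that] comb[OF that] 2 by auto
      then show ?thesis by blast
    qed
  next
    case False
    have "sdir ys m = sdir xs m" if "m < length xs" for m
      using cases[OF that] comb[OF that] False by auto
    then show ?thesis by blast
  qed
  then show ?thesis
  proof
    assume "\<forall>m < length xs. sdir ys m = sdir xs m"
    then have "ys = xs"
      using y len by (intro nth_equalityI) (simp_all add: nth_segment)
    then show ?thesis by (simp add: D)
  next
    assume "\<forall>m < length xs. sdir ys m = - sdir xs m"
    then have "ys = map (\<lambda>(i, j, e). (i, j, - e)) xs"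
      using y len by (intro nth_equalityI) (simp_all add: nth_segment[of xs])
    then show ?thesis by (simp add: D reverse_def)
  qed
qed

subsection \<open>Invariance under the moves\<close>

lemma tight_underlying:
  "tight (underlying (b, vs)) \<longleftrightarrow> is_fence (underlying (b, vs)) \<and> length vs \<le> b \<and>
     (\<forall>X. (\<forall>(i, j, e) \<in> set vs. i \<in> X \<longleftrightarrow> j \<in> X) \<longrightarrow> {1..b} \<subseteq> X \<or> {1..b} \<inter> X = {})"
  using linked_by_underlying[of b vs "{1..b}"] by (auto simp: tight_def)

lemma flow_line: "flow D \<Longrightarrow> k \<in> {1..fst D} \<Longrightarrow> (\<Sum>v \<leftarrow> snd D. inflow k v) = 0"
  by (simp only: flow_def)

lemma cyclic_passages:
  "cyclic D \<Longrightarrow> k \<in> {1..fst D} \<Longrightarrow> length (filter (\<lambda>x. x \<noteq> 0) (map (inflow k) (snd D))) \<le> 2"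
  by (simp only: cyclic_def)

text \<open>The equivalences serve moves performed in either direction. The implications reflect
  what some moves use: balance for linking under turns, balance and cyclicity for rotation under
  slides and turns.\<close>

definition same_invariants :: "labelled_fence \<Rightarrow> labelled_fence \<Rightarrow> bool" where
  "same_invariants D D' \<longleftrightarrow>
     (tight (underlying D) \<longleftrightarrow> tight (underlying D')) \<and> (flow D \<longleftrightarrow> flow D') \<and>
     (primitive D \<longleftrightarrow> primitive D') \<and>
     (length (snd D) = fst D \<longleftrightarrow> length (snd D') = fst D') \<and>
     (flow D \<longrightarrow> linking (snd D) = linking (snd D')) \<and>
     (flow D \<and> cyclic D \<longrightarrow> rotation D = rotation D')"

section \<open>Inflations and slips\<close>

lemma inflation_invariants:
  assumes "inflation D D'" "is_fence (underlying D')"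
  shows "same_invariants D D'"
  using assms inflation_tight[OF assms] inflation_length[OF assms(1)] inflation_flow[OF assms(1)]
    inflation_primitive[OF assms(1)] inflation_linking[OF assms(1)] inflation_rotation[OF assms(1)]
  by (simp add: same_invariants_def)

text \<open>Disjoint or nested segments with distinct ends have pairing 0 in both orders, and no
  line sees both, so the order of passages on each line is unchanged.\<close>

lemma slip_invariants:
  assumes "slip D D'" "is_fence (underlying D)" "is_fence (underlying D')"
  shows "same_invariants D D'"
  using assms(1)
proof cases
  case (1 i j k l b us e f ws)
  let ?v = "(i, j, e)" and ?w = "(k, l, f)"
  have lines: "i < j" "k < l"
    using assms(2) unfolding 1 is_fence_underlying by auto
  have set: "set (snd D') = set (snd D)"
    unfolding 1 by auto
  have "tight (underlying D) \<longleftrightarrow> tight (underlying D')"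
    using assms(2,3) set unfolding 1 tight_underlying snd_conv by simp
  moreover have "flow D \<longleftrightarrow> flow D'"
    by (simp add: 1 flow_def add.left_commute)
  moreover have "primitive D \<longleftrightarrow> primitive D'"
    unfolding primitive_def set ..
  moreover have "linking (snd D) = linking (snd D')"
  proof -
    have "j < k \<or> l < i \<or> k < i \<and> j < l \<or> i < k \<and> l < j"
      using 1(3,4) lines by auto
    then have "pairing ?v ?w = 0" "pairing ?w ?v = 0"
      using lines by (auto simp: pairing_def)
    then show ?thesis
      unfolding 1 snd_conv by (intro linking_replace) simp_all
  qed
  moreover have "rotation D = rotation D'"
  proof -
    have "inflow r ?v = 0 \<or> inflow r ?w = 0" for r
      using 1(3) by auto
    then have "first_nonzero (map (inflow r) (snd D)) = first_nonzero (map (inflow r) (snd D'))" for r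
      unfolding 1 by (auto simp: first_nonzero_append simp del: inflow_simps)
    then show ?thesis
      by (simp add: rotation_def) (simp add: 1)
  qed
  ultimately show ?thesis
    by (simp add: same_invariants_def 1)
qed

section \<open>Slides\<close>

lemma primitive_slide:
  assumes "\<And>d. d dvd x \<and> d dvd y \<longleftrightarrow> d dvd e \<and> d dvd (f::int)"
  shows "primitive (b, us @ [(i, j, e), (k, l, f)] @ ws) \<longleftrightarrow>
    primitive (b, us @ [(i', j', x), (k', l', y)] @ ws)"
proof -
  have "(\<forall>(i, j, e) \<in> set (us @ [(i, j, e), (k, l, f)] @ ws). d dvd e) \<longleftrightarrow>
      (\<forall>(i, j, e) \<in> set (us @ [(i', j', x), (k', l', y)] @ ws). d dvd e)" for d
    using assms[of d] by (auto simp: ball_Un)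
  then show ?thesis
    by (simp only: primitive_def snd_conv)
qed

text \<open>
  By cyclicity, two nonzero labels agree and the line \<open>j\<close> is visited only there (\<open>F1\<close>); if just one
  label is nonzero, then the line that the slide adds to the curve was not visited before (\<open>F2\<close>, \<open>F3\<close>).
\<close>

lemma slide_rotation:
  assumes D: "D = (b, us @ [(i, j, e), (j, k, f)] @ ws)" and lines: "1 \<le> i" "i < j" "j < k" "k \<le> b"
    and "flow D" "cyclic D"
  shows "rotation D = rotation (b, us @ [(i, k, f), (i, j, e - f)] @ ws)"
    and "rotation D = rotation (b, us @ [(j, k, f - e), (i, k, e)] @ ws)"
proof -
  define a w where "a = (\<lambda>r. first_nonzero (map (inflow r) us))"
    and "w = (\<lambda>r. first_nonzero (map (inflow r) ws))"
  let ?h = "\<lambda>vs r. first_nonzero (map (inflow r) vs)"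
  have in_b: "r \<in> {1..b}" if "r \<in> {i, j, k}" for r
    using that lines by auto
  have free: "a r = 0 \<and> w r = 0" if "\<forall>v \<in> set (snd D). inflow r v = 0" for r
    using that unfolding a_def w_def by (simp add: D first_nonzero_eq_0_iff del: inflow_simps)
  have F1: "e = f \<and> a j = 0 \<and> w j = 0" if ef: "e \<noteq> 0" "f \<noteq> 0"
  proof -
    have "length (filter (\<lambda>x. x \<noteq> 0) (map (inflow j) (snd D))) \<le> 2"
      using \<open>cyclic D\<close> in_b[of j] by (intro cyclic_passages) (simp_all add: D)
    then have none: "filter (\<lambda>x. x \<noteq> 0) (map (inflow j) us) = []" "filter (\<lambda>x. x \<noteq> 0) (map (inflow j) ws) = []"
      using ef lines by (simp_all add: D filter_map)
    then have zero: "\<And>v. v \<in> set us \<Longrightarrow> inflow j v = 0" "\<And>v. v \<in> set ws \<Longrightarrow> inflow j v = 0"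
      by (auto simp: filter_empty_conv simp del: inflow_simps)
    have "map (inflow j) us = map (\<lambda>_. 0) us" "map (inflow j) ws = map (\<lambda>_. 0) ws"
      using zero by (simp_all only: map_eq_conv) blast+
    then have "(\<Sum>v \<leftarrow> us. inflow j v) = 0" "(\<Sum>v \<leftarrow> ws. inflow j v) = 0"
      by (simp_all only: sum_list_0)
    moreover have "(\<Sum>v \<leftarrow> snd D. inflow j v) = 0"
      using \<open>flow D\<close> in_b[of j] by (intro flow_line) (simp_all add: D)
    ultimately have "e = f"
      using lines by (simp add: D)
    then show ?thesis
      using zero by (auto simp: a_def w_def first_nonzero_eq_0_iff simp del: inflow_simps)
  qed
  have F2: "a i = 0 \<and> w i = 0" if "e = 0" "f \<noteq> 0"
  proof -
    have "(i, j, 0) \<in> set (snd D)" "(j, k, f) \<in> set (snd D)" "inflow j (j, k, f) \<noteq> 0"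
      using that lines by (simp_all add: D)
    then have "\<forall>v \<in> set (snd D). inflow i v = 0"
      using \<open>cyclic D\<close> unfolding cyclic_def by fast
    then show ?thesis by (rule free)
  qed
  have F3: "a k = 0 \<and> w k = 0" if "e \<noteq> 0" "f = 0"
  proof -
    have "(j, k, 0) \<in> set (snd D)" "(i, j, e) \<in> set (snd D)" "inflow j (i, j, e) \<noteq> 0"
      using that lines by (simp_all add: D)
    then have "\<forall>v \<in> set (snd D). inflow k v = 0"
      using \<open>cyclic D\<close> unfolding cyclic_def by fast
    then show ?thesis by (rule free)
  qed
  have append: "?h (us @ [(p, q, x), (p', q', y)] @ ws) r = (if a r \<noteq> 0 then a r
      else if inflow r (p, q, x) \<noteq> 0 then inflow r (p, q, x)
      else if inflow r (p', q', y) \<noteq> 0 then inflow r (p', q', y) else w r)" for p q x p' q' y r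
    by (simp add: first_nonzero_append a_def w_def del: inflow_simps)
  \<comment> \<open>A slide affects passages only on the lines i, j, k, so comparing the rotations
    is a finite check over which of e and f vanish.\<close>
  have diff: "(\<Sum>r \<in> {1..b}. ?h vs' r) - (\<Sum>r \<in> {1..b}. ?h (snd D) r) =
      (?h vs' i - ?h (snd D) i) + (?h vs' j - ?h (snd D) j) + (?h vs' k - ?h (snd D) k)"
    if "\<And>r. r \<notin> {i, j, k} \<Longrightarrow> ?h vs' r = ?h (snd D) r" for vs'
  proof -
    have "(\<Sum>r \<in> {1..b}. ?h vs' r) - (\<Sum>r \<in> {1..b}. ?h (snd D) r) = (\<Sum>r \<in> {1..b}. ?h vs' r - ?h (snd D) r)"
      by (simp add: sum_subtractf)
    also have "\<dots> = (\<Sum>r \<in> {i, j, k}. ?h vs' r - ?h (snd D) r)"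
      using in_b that by (intro sum.mono_neutral_right) auto
    finally show ?thesis
      using lines by simp
  qed
  have labels: "(\<Sum>(i, j, e) \<leftarrow> us @ [(p, q, x), (p', q', y)] @ ws. e) =
      (\<Sum>(i, j, e) \<leftarrow> us. e) + (\<Sum>(i, j, e) \<leftarrow> ws. e) + x + y" for p q p' q' :: nat and x y :: int
    by simp
  have goal: "rotation D = rotation (b, us @ [(p, q, x), (p', q', y)] @ ws)"
    if "\<And>r. r \<notin> {i, j, k} \<Longrightarrow> ?h (us @ [(p, q, x), (p', q', y)] @ ws) r = ?h (snd D) r"
      and "x + y - (e + f) = (?h (us @ [(p, q, x), (p', q', y)] @ ws) i - ?h (snd D) i) +
        (?h (us @ [(p, q, x), (p', q', y)] @ ws) j - ?h (snd D) j) +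
        (?h (us @ [(p, q, x), (p', q', y)] @ ws) k - ?h (snd D) k)" for p q p' q' x y
    using diff[of "us @ [(p, q, x), (p', q', y)] @ ws", OF that(1)] that(2)
    unfolding rotation_def D snd_conv fst_conv labels by linarith
  show "rotation D = rotation (b, us @ [(i, k, f), (i, j, e - f)] @ ws)"
  proof (rule goal)
    show "?h (us @ [(i, k, f), (i, j, e - f)] @ ws) r = ?h (snd D) r" if "r \<notin> {i, j, k}" for r
      using that unfolding D snd_conv append by simp
    show "f + (e - f) - (e + f) = (?h (us @ [(i, k, f), (i, j, e - f)] @ ws) i - ?h (snd D) i) +
        (?h (us @ [(i, k, f), (i, j, e - f)] @ ws) j - ?h (snd D) j) +
        (?h (us @ [(i, k, f), (i, j, e - f)] @ ws) k - ?h (snd D) k)"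
      unfolding D snd_conv append using lines F1 F2 F3 by (cases "e = 0"; cases "f = 0") simp_all
  qed
  show "rotation D = rotation (b, us @ [(j, k, f - e), (i, k, e)] @ ws)"
  proof (rule goal)
    show "?h (us @ [(j, k, f - e), (i, k, e)] @ ws) r = ?h (snd D) r" if "r \<notin> {i, j, k}" for r
      using that unfolding D snd_conv append by simp
    show "f - e + e - (e + f) = (?h (us @ [(j, k, f - e), (i, k, e)] @ ws) i - ?h (snd D) i) +
        (?h (us @ [(j, k, f - e), (i, k, e)] @ ws) j - ?h (snd D) j) +
        (?h (us @ [(j, k, f - e), (i, k, e)] @ ws) k - ?h (snd D) k)"
      unfolding D snd_conv append using lines F1 F2 F3 by (cases "e = 0"; cases "f = 0") simp_all
  qed
qed

text \<open>A passage from i to k is one from i to j followed by one from j to k; the half-open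
  intervals fit together without counting j twice.\<close>

lemma pairing_split:
  assumes "i < j" "j < k"
  shows "pairing u (i, k, f) = pairing u (i, j, f) + pairing u (j, k, f)"
    "pairing (i, k, f) w = pairing (i, j, f) w + pairing (j, k, f) w"
proof -
  have "of_bool (i < c \<and> c \<le> k) = of_bool (i < c \<and> c \<le> j) + (of_bool (j < c \<and> c \<le> k) :: int)" for c
    using assms by auto
  then show "pairing u (i, k, f) = pairing u (i, j, f) + pairing u (j, k, f)"
    by (cases u) (simp add: pairing_def algebra_simps)
  show "pairing (i, k, f) w = pairing (i, j, f) w + pairing (j, k, f) w"
    by (cases w) (simp add: pairing_def algebra_simps)
qed

lemma pairing_diff:
  "pairing u (i, j, e - f) = pairing u (i, j, e) - pairing u (i, j, f)"
  "pairing (i, j, e - f) w = pairing (i, j, e) w - pairing (i, j, f) w"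
  by (cases u; cases w; simp add: pairing_def algebra_simps)+

text \<open>The label rules keep the boundary and the total pairing with every other segment, by
  \<open>pairing_split\<close> and bilinearity; within the pair, the pairing is 0 before and
  after.\<close>

lemma slide_invariants:
  assumes "slide D D'" "is_fence (underlying D)" "is_fence (underlying D')"
  shows "same_invariants D D'"
proof -
  obtain b us ws i j k e f where D: "D = (b, us @ [(i, j, e), (j, k, f)] @ ws)" and ijk: "i < j" "j < k"
    and D': "D' = (b, us @ [(i, k, f), (i, j, e - f)] @ ws) \<or> D' = (b, us @ [(j, k, f - e), (i, k, e)] @ ws)"
    using assms(1) by cases blast+
  have lines: "1 \<le> i" "k \<le> b"
    using assms(2) unfolding D is_fence_underlying by auto
  have size: "fst D' = fst D" "length (snd D') = length (snd D)"
    using D D' by auto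
  have "(\<forall>(i, j, e) \<in> set (snd D). i \<in> X \<longleftrightarrow> j \<in> X) \<longleftrightarrow> (\<forall>(i, j, e) \<in> set (snd D'). i \<in> X \<longleftrightarrow> j \<in> X)" for X
    using D' unfolding D by (auto simp: ball_Un)
  then have "tight (underlying D) \<longleftrightarrow> tight (underlying D')"
    using assms(2,3) size
    unfolding tight_underlying[of "fst D" "snd D", unfolded prod.collapse]
      tight_underlying[of "fst D'" "snd D'", unfolded prod.collapse] by simp
  moreover have "flow D \<longleftrightarrow> flow D'"
  proof -
    have "(\<Sum>v \<leftarrow> snd D. inflow r v) = (\<Sum>v \<leftarrow> snd D'. inflow r v)" for r
      using D' ijk by (auto simp: D)
    then show ?thesis
      using size by (simp add: flow_def)
  qed
  moreover have "primitive D \<longleftrightarrow> primitive D'"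
    using D'
  proof
    assume "D' = (b, us @ [(i, k, f), (i, j, e - f)] @ ws)"
    then show ?thesis
      unfolding D by (simp only:, intro primitive_slide) (auto simp: dvd_diff_left_iff)
  next
    assume "D' = (b, us @ [(j, k, f - e), (i, k, e)] @ ws)"
    then show ?thesis
      unfolding D by (simp only:, intro primitive_slide) (auto simp: dvd_diff_left_iff)
  qed
  moreover have "linking (snd D) = linking (snd D')"
    using D'
  proof
    assume "D' = (b, us @ [(i, k, f), (i, j, e - f)] @ ws)"
    then show ?thesis
      unfolding D snd_conv using ijk
      by (simp only: snd_conv, intro linking_replace)
        (simp add: pairing_split[OF ijk] pairing_diff, simp add: pairing_split[OF ijk] pairing_diff,
          simp add: pairing_def)
  next
    assume "D' = (b, us @ [(j, k, f - e), (i, k, e)] @ ws)"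
    then show ?thesis
      unfolding D snd_conv using ijk
      by (simp only: snd_conv, intro linking_replace)
        (simp add: pairing_split[OF ijk] pairing_diff, simp add: pairing_split[OF ijk] pairing_diff,
          simp add: pairing_def)
  qed
  moreover have "rotation D = rotation D'" if "flow D" "cyclic D"
    using slide_rotation[OF D lines(1) ijk lines(2) that] D' by blast
  ultimately show ?thesis
    using size by (simp add: same_invariants_def)
qed

section \<open>Turns\<close>

lemma sum_list_pairing_flow:
  assumes fence: "is_fence (underlying (b, vs))" and flow: "flow (b, vs)"
    and v: "1 \<le> i" "i < j" "j \<le> b"
  shows "(\<Sum>w \<leftarrow> vs. pairing (i, j, e) w) = 0" "(\<Sum>w \<leftarrow> vs. pairing w (i, j, e)) = 0"
proof -
  have seg: "1 \<le> fst w \<and> fst w < fst (snd w) \<and> fst (snd w) \<le> b" if "w \<in> set vs" for w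
    using fence that unfolding is_fence_underlying by fastforce
  \<comment> \<open>That w crosses a level c is read off the net inflow of w into the lines c, ...,
    b. Summed over a flow, this vanishes: a closed curve crosses each level equally often in both
    directions.\<close>
  have level: "pairing (i, j, e) w =
      e * ((\<Sum>k \<in> {j - 1<..b}. inflow k w) - (\<Sum>k \<in> {i - 1<..b}. inflow k w))" if "w \<in> set vs" for w
  proof (cases w)
    case (fields k l f)
    have "1 \<le> k" "k < l" "l \<le> b"
      using seg[OF that] fields by auto
    then show ?thesis
      using v unfolding fields by (subst (1 2) sum_inflow_interval) (auto simp: pairing_def of_bool_def)
  qed
  have zero: "(\<Sum>w \<leftarrow> vs. \<Sum>k \<in> {c<..d}. inflow k w) = 0" if "d \<le> b" for c d
    using that by (intro sum_list_inflow_interval[OF flow]) auto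
  have "(\<Sum>w \<leftarrow> vs. pairing (i, j, e) w) =
      (\<Sum>w \<leftarrow> vs. e * ((\<Sum>k \<in> {j - 1<..b}. inflow k w) - (\<Sum>k \<in> {i - 1<..b}. inflow k w)))"
    using level by (simp cong: map_cong)
  also have "\<dots> = 0"
    by (simp only: sum_list_const_mult sum_list_subtractf zero[OF order_refl]) simp
  finally show "(\<Sum>w \<leftarrow> vs. pairing (i, j, e) w) = 0" .
  have "pairing w (i, j, e) = e * (\<Sum>k \<in> {i<..j}. inflow k w)" if "w \<in> set vs" for w
    using seg[OF that] by (intro pairing_eq_sum_inflow) simp
  then have "(\<Sum>w \<leftarrow> vs. pairing w (i, j, e)) = (\<Sum>w \<leftarrow> vs. e * (\<Sum>k \<in> {i<..j}. inflow k w))"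
    by (simp cong: map_cong)
  also have "\<dots> = 0"
    by (simp only: sum_list_const_mult zero[OF v(3)] mult_zero_right)
  finally show "(\<Sum>w \<leftarrow> vs. pairing w (i, j, e)) = 0" .
qed

lemma first_nonzero_single:
  "length (filter (\<lambda>x. x \<noteq> 0) xs) \<le> 1 \<Longrightarrow> first_nonzero xs = sum_list xs"
proof (induction xs)
  case (Cons x xs)
  show ?case
  proof (cases "x = 0")
    case False
    then have "\<forall>y \<in> set xs. y = 0"
      using Cons.prems by (simp add: filter_empty_conv)
    then have "sum_list xs = 0"
      by (induction xs) auto
    then show ?thesis
      using False by simp
  qed (use Cons in simp)
qed simp

text \<open>The turned segment has total pairing 0 with the flow from either side. On its two lines
  the first passage becomes the last, which reverses the directions there; the changes 2 * e and -2
  * e cancel.\<close>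

lemma turn_invariants:
  assumes "turn D D'" "is_fence (underlying D)" "is_fence (underlying D')"
  shows "same_invariants D D'"
  using assms(1)
proof cases
  case (1 b v vs)
  obtain i j e where v: "v = (i, j, e)" by (cases v)
  have D: "D = (b, (i, j, e) # vs)" and D': "D' = (b, vs @ [(i, j, e)])"
    using 1 v by simp_all
  have lines: "1 \<le> i" "i < j" "j \<le> b"
    using assms(2) unfolding D is_fence_underlying by auto
  have set: "set (snd D') = set (snd D)"
    unfolding D D' by auto
  have "tight (underlying D) \<longleftrightarrow> tight (underlying D')"
    using assms(2,3) set unfolding D D' tight_underlying snd_conv by simp
  moreover have "flow D \<longleftrightarrow> flow D'"
    by (simp add: D D' flow_def add.commute)
  moreover have "primitive D \<longleftrightarrow> primitive D'"
    unfolding primitive_def set ..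
  moreover have "linking (snd D) = linking (snd D')" if "flow D"
  proof -
    \<comment> \<open>Both sums contain the pairing of the segment with itself, so the sums over the
      other segments agree.\<close>
    have "(\<Sum>w \<leftarrow> (i, j, e) # vs. pairing (i, j, e) w) = 0" "(\<Sum>w \<leftarrow> (i, j, e) # vs. pairing w (i, j, e)) = 0"
      using sum_list_pairing_flow assms(2) that lines unfolding D by blast+
    then show ?thesis
      by (simp add: D D' linking_append)
  qed
  moreover have "rotation D = rotation D'" if "flow D" "cyclic D"
  proof -
    let ?h = "\<lambda>D r. first_nonzero (map (inflow r) (snd D))"
    have change: "?h D' r - ?h D r = (if r = i then 2 * e else if r = j then - 2 * e else 0)"
      if r: "r \<in> {1..b}" for r
    proof (cases "inflow r (i, j, e) = 0")
      case True
      then have "?h D' r = ?h D r"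
        by (simp add: D D' first_nonzero_append del: inflow_simps)
      with True lines show ?thesis
        by (auto split: if_splits)
    next
      case False
      have "length (filter (\<lambda>x. x \<noteq> 0) (map (inflow r) (snd D))) \<le> 2"
        using \<open>cyclic D\<close> r by (intro cyclic_passages) (simp_all add: D)
      then have "length (filter (\<lambda>x. x \<noteq> 0) (map (inflow r) vs)) \<le> 1"
        using False by (simp add: D filter_map del: inflow_simps)
      then have "first_nonzero (map (inflow r) vs) = (\<Sum>v \<leftarrow> vs. inflow r v)"
        by (rule first_nonzero_single)
      also have "\<dots> = - inflow r (i, j, e)"
        using flow_line[OF \<open>flow D\<close>, of r] r by (simp add: D add_eq_0_iff del: inflow_simps)
      finally have "?h D' r - ?h D r = - 2 * inflow r (i, j, e)"
        using False by (simp add: D D' first_nonzero_append del: inflow_simps)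
      with False lines show ?thesis
        by (auto split: if_splits)
    qed
    have "(\<Sum>r \<in> {1..b}. ?h D' r) - (\<Sum>r \<in> {1..b}. ?h D r) = (\<Sum>r \<in> {1..b}. ?h D' r - ?h D r)"
      by (simp add: sum_subtractf)
    also have "\<dots> = (\<Sum>r \<in> {1..b}. (if r = i then 2 * e else 0) - (if r = j then 2 * e else 0))"
      using change lines by (intro sum.cong) auto
    also have "\<dots> = 0"
      using lines by (simp only: sum_subtractf) simp
    finally have "(\<Sum>r \<in> {1..b}. ?h D' r) = (\<Sum>r \<in> {1..b}. ?h D r)"
      by simp
    moreover have "(\<Sum>(i, j, e) \<leftarrow> snd D'. e) = (\<Sum>(i, j, e) \<leftarrow> snd D. e)"
      by (simp add: D D')
    moreover have "fst D = b" "fst D' = b"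
      by (simp_all add: D D')
    ultimately show ?thesis
      unfolding rotation_def by (simp only:)
  qed
  ultimately show ?thesis
    by (simp add: same_invariants_def D D')
qed

section \<open>Twirls\<close>

definition twirl_line :: "nat \<Rightarrow> nat \<Rightarrow> nat" where
  "twirl_line b k = (if k = 1 then b else k - 1)"

lemma bij_betw_twirl_line: "1 \<le> b \<Longrightarrow> bij_betw (twirl_line b) {1..b} {1..b}"
  by (rule bij_betw_byWitness[where f' = "\<lambda>k. if k = b then 1 else k + 1"])
    (auto simp: twirl_line_def)

text \<open>The cyclic shift of the lines swaps upper and lower end exactly for segments at the top,
  where the sign change of the label compensates.\<close>

lemma inflow_twirl:
  assumes "1 \<le> i" "i < j" "j \<le> b" "k \<in> {1..b}"
  shows "inflow (twirl_line b k) (twirl_seg b (i, j, e)) = inflow k (i, j, e)"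
proof -
  obtain i' j' k' where suc: "i = Suc i'" "j = Suc j'" "k = Suc k'"
    using assms by (metis Suc_pred' atLeastAtMost_iff less_le_trans zero_less_one less_trans)
  show ?thesis
    using assms unfolding suc
    by (cases "i' = 0"; cases "k' = 0") (simp_all add: twirl_line_def twirl_seg_def)
qed

text \<open>If the second segment starts at the top, its interval is replaced by the complement:
  each indicator becomes 1 minus the old one. The constant cancels between the two ends of the first
  segment, and the minus sign is absorbed by the label.\<close>

lemma pairing_twirl:
  assumes "1 \<le> i" "i < j" "j \<le> b" "1 \<le> k" "k < l" "l \<le> b"
  shows "pairing (twirl_seg b (i, j, e)) (twirl_seg b (k, l, f)) = pairing (i, j, e) (k, l, f)"
proof -
  obtain i' j' k' l' where suc: "i = Suc i'" "j = Suc j'" "k = Suc k'" "l = Suc l'"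
    using assms by (metis Suc_pred' less_le_trans zero_less_one less_trans)
  show ?thesis
    using assms unfolding suc
    by (cases "i' = 0"; cases "k' = 0") (simp_all add: twirl_seg_def pairing_def of_bool_def)
qed

lemma twirl_invariants:
  assumes "twirl D D'" "is_fence (underlying D)" "is_fence (underlying D')"
  shows "same_invariants D D'"
  using assms(1)
proof cases
  case (1 b vs)
  let ?\<pi> = "twirl_line b" and ?ws = "map (twirl_seg b) vs"
  have D: "D = (b, vs)" and D': "D' = (b, ?ws)"
    using 1 by simp_all
  have "1 \<le> b" and lines: "\<And>i j e. (i, j, e) \<in> set vs \<Longrightarrow> 1 \<le> i \<and> i < j \<and> j \<le> b"
    using assms(2) unfolding D is_fence_underlying by auto
  note bij = bij_betw_twirl_line[OF \<open>1 \<le> b\<close>]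
  then have range: "{1..b} = ?\<pi> ` {1..b}" and inj: "inj_on ?\<pi> {1..b}"
    by (simp_all add: bij_betw_def)
  have inflow: "inflow (?\<pi> k) (twirl_seg b v) = inflow k v" if "v \<in> set vs" "k \<in> {1..b}" for v k
    using lines that by (cases v) (auto intro!: inflow_twirl simp del: inflow_simps)
  then have map_inflow: "map (inflow (?\<pi> k)) ?ws = map (inflow k) vs" if "k \<in> {1..b}" for k
    using that by simp
  have respects: "(\<forall>(i, j, e) \<in> set ?ws. i \<in> X \<longleftrightarrow> j \<in> X) \<longleftrightarrow>
      (\<forall>(i, j, e) \<in> set vs. ?\<pi> i \<in> X \<longleftrightarrow> ?\<pi> j \<in> X)" for X
  proof -
    have "(case twirl_seg b v of (i, j, e) \<Rightarrow> i \<in> X \<longleftrightarrow> j \<in> X) \<longleftrightarrow>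
        (case v of (i, j, e) \<Rightarrow> ?\<pi> i \<in> X \<longleftrightarrow> ?\<pi> j \<in> X)" if "v \<in> set vs" for v
      using lines that by (cases v) (auto simp: twirl_seg_def twirl_line_def)
    then show ?thesis
      by simp
  qed
  have "(\<forall>X. (\<forall>(i, j, e) \<in> set vs. i \<in> X \<longleftrightarrow> j \<in> X) \<longrightarrow> {1..b} \<subseteq> X \<or> {1..b} \<inter> X = {}) \<longleftrightarrow>
      (\<forall>X. (\<forall>(i, j, e) \<in> set ?ws. i \<in> X \<longleftrightarrow> j \<in> X) \<longrightarrow> {1..b} \<subseteq> X \<or> {1..b} \<inter> X = {})" (is "?L \<longleftrightarrow> ?R")
  proof
    assume L: ?L
    show ?R
    proof (intro allI impI)
      fix X assume "\<forall>(i, j, e) \<in> set ?ws. i \<in> X \<longleftrightarrow> j \<in> X"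
      then have "{1..b} \<subseteq> {k. ?\<pi> k \<in> X} \<or> {1..b} \<inter> {k. ?\<pi> k \<in> X} = {}"
        unfolding respects by (intro L[THEN spec, THEN mp]) simp
      then have "?\<pi> ` {1..b} \<subseteq> X \<or> ?\<pi> ` {1..b} \<inter> X = {}"
        by blast
      then show "{1..b} \<subseteq> X \<or> {1..b} \<inter> X = {}"
        unfolding range[symmetric] .
    qed
  next
    assume R: ?R
    show ?L
    proof (intro allI impI)
      fix X assume X: "\<forall>(i, j, e) \<in> set vs. i \<in> X \<longleftrightarrow> j \<in> X"
      let ?Y = "?\<pi> ` (X \<inter> {1..b})"
      have mem: "?\<pi> k \<in> ?Y \<longleftrightarrow> k \<in> X" if "k \<in> {1..b}" for k
        using inj_on_image_mem_iff[OF inj that, of "X \<inter> {1..b}"] that by blast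
      have "\<forall>(i, j, e) \<in> set vs. ?\<pi> i \<in> ?Y \<longleftrightarrow> ?\<pi> j \<in> ?Y"
      proof (intro ballI, clarify)
        fix i j e assume v: "(i, j, e) \<in> set vs"
        then have "i \<in> {1..b}" "j \<in> {1..b}"
          using lines[OF v] by auto
        then show "?\<pi> i \<in> ?Y \<longleftrightarrow> ?\<pi> j \<in> ?Y"
          using X v mem by fast
      qed
      then have "{1..b} \<subseteq> ?Y \<or> {1..b} \<inter> ?Y = {}"
        unfolding respects[symmetric] by (intro R[THEN spec, THEN mp])
      moreover have "?\<pi> k \<in> {1..b}" if "k \<in> {1..b}" for k
        using range that by blast
      ultimately show "{1..b} \<subseteq> X \<or> {1..b} \<inter> X = {}"
        using mem by blast
    qed
  qed
  then have "tight (underlying D) \<longleftrightarrow> tight (underlying D')"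
    using assms(2,3) unfolding D D' tight_underlying by simp
  moreover have flow: "flow D \<longleftrightarrow> flow D'"
  proof -
    have "flow D' \<longleftrightarrow> (\<forall>k \<in> ?\<pi> ` {1..b}. (\<Sum>v \<leftarrow> ?ws. inflow k v) = 0)"
      by (simp only: flow_def D' fst_conv snd_conv range[symmetric])
    also have "\<dots> \<longleftrightarrow> flow D"
      by (simp add: flow_def D map_inflow del: map_map)
    finally show ?thesis ..
  qed
  moreover have "primitive D \<longleftrightarrow> primitive D'"
  proof -
    have "d dvd snd (snd (twirl_seg b v)) \<longleftrightarrow> d dvd snd (snd v)" for d v
      by (simp add: twirl_seg_def case_prod_unfold)
    then show ?thesis
      by (simp add: primitive_def D D' case_prod_unfold)
  qed
  moreover have "linking (snd D) = linking (snd D')"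
    unfolding D D' snd_conv
  proof (rule linking_map[symmetric])
    fix u w assume uw: "u \<in> set vs" "w \<in> set vs"
    obtain i j e k l f where "u = (i, j, e)" "w = (k, l, f)"
      by (metis prod_cases3)
    with uw show "pairing (twirl_seg b u) (twirl_seg b w) = pairing u w"
      using lines[of i j e] lines[of k l f] by (simp add: pairing_twirl)
  qed
  moreover have "rotation D = rotation D'" if "flow D"
  proof -
    have "(\<Sum>k \<in> {1..b}. first_nonzero (map (inflow k) ?ws)) =
        (\<Sum>k \<in> {1..b}. first_nonzero (map (inflow (?\<pi> k)) ?ws))"
      by (rule sum.reindex_bij_betw[OF bij, symmetric])
    also have "\<dots> = (\<Sum>k \<in> {1..b}. first_nonzero (map (inflow k) vs))"
      by (simp add: map_inflow del: map_map)
    finally have lines_eq: "(\<Sum>k \<in> {1..b}. first_nonzero (map (inflow k) ?ws)) = \<dots>" .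
    \<comment> \<open>Only labels at the top line change sign. Their total change is twice the
      inflow there, which is 0 for a flow.\<close>
    have "(\<Sum>(i, j, e) \<leftarrow> ?ws. e) = (\<Sum>(i, j, e) \<leftarrow> vs. e) + 2 * (\<Sum>v \<leftarrow> vs. inflow 1 v)"
    proof -
      have "(case twirl_seg b v of (i, j, e) \<Rightarrow> e) = (case v of (i, j, e) \<Rightarrow> e) + 2 * inflow 1 v"
        if "v \<in> set vs" for v
        using lines that by (cases v) (auto simp: twirl_seg_def)
      then have "map (\<lambda>(i, j, e). e) ?ws = map (\<lambda>v. (case v of (i, j, e) \<Rightarrow> e) + 2 * inflow 1 v) vs"
        by simp
      then show ?thesis
        by (simp only: sum_list_addf sum_list_const_mult)
    qed
    moreover have "(\<Sum>v \<leftarrow> vs. inflow 1 v) = 0"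
      using flow_line[OF that, of 1] \<open>1 \<le> b\<close> by (simp add: D)
    ultimately show ?thesis
      using lines_eq by (simp only: rotation_def D D' fst_conv snd_conv)
  qed
  ultimately show ?thesis
    by (simp add: same_invariants_def D D')
qed

lemma basic_move_invariants:
  assumes "basic_move D D'" "is_fence (underlying D)" "is_fence (underlying D')"
  shows "same_invariants D D'"
  using assms inflation_invariants slip_invariants slide_invariants twirl_invariants turn_invariants
  unfolding basic_move_def by blast

subsection \<open>Carrying orientations along the moves\<close>

lemma map_eq_append3:
  assumes "map f xs = map g us @ map g vs @ map g ws"
  obtains us' vs' ws' where "xs = us' @ vs' @ ws'"
    "map f us' = map g us" "map f vs' = map g vs" "map f ws' = map g ws"
proof -
  obtain us' zs where us': "xs = us' @ zs" "map g us = map f us'" "map g vs @ map g ws = map f zs"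
    using assms unfolding map_eq_append_conv by blast
  obtain vs' ws' where "zs = vs' @ ws'" "map g vs = map f vs'" "map g ws = map f ws'"
    using us'(3)[symmetric] unfolding map_eq_append_conv by blast
  with us' show thesis
    by (intro that[of us' vs' ws']) simp_all
qed

lemma underlying_append:
  assumes "underlying D = underlying (b, us @ vs @ ws)"
  obtains us' vs' ws' where "D = (b, us' @ vs' @ ws')"
    "map ends us' = map ends us" "map ends vs' = map ends vs" "map ends ws' = map ends ws"
proof -
  obtain xs where D: "D = (b, xs)"
    using assms by (metis fst_conv fst_underlying prod.collapse)
  then have "map ends xs = map ends us @ map ends vs @ map ends ws"
    using assms by simp
  then show thesis
    by (rule map_eq_append3) (use that D in simp)
qed

lemma map_ends_pair:
  assumes "map ends vs = map ends [(i, j, e), (k, l, f)]"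
  obtains e' f' where "vs = [(i, j, e'), (k, l, f')]"
  using assms by (auto simp: map_eq_Cons_conv)

lemma map_ends_cong:
  assumes "\<And>i j e e'. ends (g (i, j, e)) = ends (g (i, j, e'))"
    and "map ends xs = map ends us"
  shows "map ends (map g xs) = map ends (map g us)"
  using assms(2)
proof (induction us arbitrary: xs)
  case (Cons u us)
  obtain i j e where u: "u = (i, j, e)" by (cases u)
  then obtain e' ys where "xs = (i, j, e') # ys" "map ends ys = map ends us"
    using Cons.prems by (auto simp: map_eq_Cons_conv)
  then show ?case
    using Cons.IH[of ys] assms(1)[of i j e' e] u by (simp only: list.map)
qed simp

lemma map_ends_preimage:
  assumes "\<And>i j e e'. ends (g (i, j, e)) = ends (g (i, j, e'))"
    and "\<And>i j f. \<exists>e. snd (snd (g (i, j, e))) = f"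
    and "map ends xs = map ends (map g us)"
  shows "\<exists>ys. map ends ys = map ends us \<and> xs = map g ys"
  using assms(3)
proof (induction us arbitrary: xs)
  case (Cons u us)
  obtain i j e where u: "u = (i, j, e)" by (cases u)
  obtain x zs where xs: "xs = x # zs" "ends x = ends (g u)"
    "map ends zs = map ends (map g us)"
    using Cons.prems by (auto simp: map_eq_Cons_conv)
  obtain ys where ys: "map ends ys = map ends us" "zs = map g ys"
    using Cons.IH[OF xs(3)] by blast
  obtain e' where "snd (snd (g (i, j, e'))) = snd (snd x)"
    using assms(2) by blast
  moreover have "ends (g (i, j, e')) = ends x"
    using xs(2) assms(1)[of i j e' e] u by simp
  ultimately have "g (i, j, e') = x"
    by (simp add: ends_def case_prod_unfold prod_eq_iff)
  then show ?case
    using ys xs(1) u by (intro exI[of _ "(i, j, e') # ys"]) simp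
qed simp

lemma lift_seg_ends:
  "ends (lift_seg p (i, j, e)) = ends (lift_seg p (i, j, e'))"
  "\<exists>e. snd (snd (lift_seg p (i, j, e))) = f"
  by simp_all

lemma twirl_seg_ends:
  "ends (twirl_seg b (i, j, e)) = ends (twirl_seg b (i, j, e'))"
  "\<exists>e. snd (snd (twirl_seg b (i, j, e))) = f"
  by (simp add: twirl_seg_def, cases "i = 1")
    (auto simp: twirl_seg_def intro: exI[of _ "- f"])

text \<open>The rules of the moves depend only on the ends of the segments, so the same move applies
  to any other labelling C of the diagram.\<close>

lemma carry_forward:
  assumes "basic_move D D'" "underlying C = underlying D"
  shows "\<exists>C'. underlying C' = underlying D' \<and> basic_move C C'"
  using assms(1) unfolding basic_move_def
proof (elim disjE)
  assume "inflation D D'"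
  then show "\<exists>C'. underlying C' = underlying D' \<and> (inflation C C' \<or> slip C C' \<or> slide C C' \<or> twirl C C' \<or> turn C C')"
  proof cases
    case (1 p b q us ws)
    obtain us' vs' ws' where C: "C = (b, us' @ vs' @ ws')"
      and m: "map ends us' = map ends us"
        "map ends vs' = map ends []"
        "map ends ws' = map ends ws"
      using underlying_append[of C b us "[]" ws] assms(2) 1 by auto
    have "inflation C (b + 1, map (lift_seg p) us' @
        [(min p (lift_line p q), max p (lift_line p q), 0)] @ map (lift_seg p) ws')"
      using inflation.intros[OF 1(3-6), of us' ws'] C m(2) by simp
    moreover note map_ends_cong[of "lift_seg p", OF lift_seg_ends(1) m(1)]
      map_ends_cong[of "lift_seg p", OF lift_seg_ends(1) m(3)]
    ultimately show ?thesis
      unfolding 1 by (intro exI conjI disjI1) (simp_all del: map_map)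
  qed
next
  assume "slip D D'"
  then show "\<exists>C'. underlying C' = underlying D' \<and> (inflation C C' \<or> slip C C' \<or> slide C C' \<or> twirl C C' \<or> turn C C')"
  proof cases
    case (1 i j k l b us e f ws)
    obtain us' vs' ws' where C: "C = (b, us' @ vs' @ ws')"
      and m: "map ends us' = map ends us"
        "map ends vs' = map ends [(i, j, e), (k, l, f)]"
        "map ends ws' = map ends ws"
      using assms(2) unfolding 1 by (rule underlying_append)
    obtain e' f' where "vs' = [(i, j, e'), (k, l, f')]"
      using m(2) by (rule map_ends_pair)
    then have "slip C (b, us' @ [(k, l, f'), (i, j, e')] @ ws')"
      using slip.intros[OF 1(3,4), of b us' e' f' ws'] C by simp
    then show ?thesis
      using m unfolding 1 by (intro exI conjI, rule_tac [2] disjI2, rule_tac [2] disjI1) simp_all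
  qed
next
  assume "slide D D'"
  then show "\<exists>C'. underlying C' = underlying D' \<and> (inflation C C' \<or> slip C C' \<or> slide C C' \<or> twirl C C' \<or> turn C C')"
  proof cases
    case (1 i j k b us e f ws)
    obtain us' vs' ws' where C: "C = (b, us' @ vs' @ ws')"
      and m: "map ends us' = map ends us"
        "map ends vs' = map ends [(i, j, e), (j, k, f)]"
        "map ends ws' = map ends ws"
      using assms(2) unfolding 1 by (rule underlying_append)
    obtain e' f' where "vs' = [(i, j, e'), (j, k, f')]"
      using m(2) by (rule map_ends_pair)
    then have "slide C (b, us' @ [(i, k, f'), (i, j, e' - f')] @ ws')"
      using slide.intros(1)[OF 1(3,4), of b us' e' f' ws'] C by simp
    moreover have "underlying (b, us' @ [(i, k, f'), (i, j, e' - f')] @ ws') = underlying D'"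
      using m by (simp add: 1)
    ultimately show ?thesis by blast
  next
    case (2 i j k b us e f ws)
    obtain us' vs' ws' where C: "C = (b, us' @ vs' @ ws')"
      and m: "map ends us' = map ends us"
        "map ends vs' = map ends [(i, j, e), (j, k, f)]"
        "map ends ws' = map ends ws"
      using assms(2) unfolding 2 by (rule underlying_append)
    obtain e' f' where "vs' = [(i, j, e'), (j, k, f')]"
      using m(2) by (rule map_ends_pair)
    then have "slide C (b, us' @ [(j, k, f' - e'), (i, k, e')] @ ws')"
      using slide.intros(2)[OF 2(3,4), of b us' e' f' ws'] C by simp
    moreover have "underlying (b, us' @ [(j, k, f' - e'), (i, k, e')] @ ws') = underlying D'"
      using m by (simp add: 2)
    ultimately show ?thesis by blast
  qed
next
  assume "twirl D D'"
  then show "\<exists>C'. underlying C' = underlying D' \<and> (inflation C C' \<or> slip C C' \<or> slide C C' \<or> twirl C C' \<or> turn C C')"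
  proof cases
    case (1 b vs)
    obtain xs where C: "C = (b, xs)" "map ends xs = map ends vs"
      using assms(2) 1 by (cases C) auto
    have "twirl C (b, map (twirl_seg b) xs)"
      unfolding C by (rule twirl.intros)
    moreover have "underlying (b, map (twirl_seg b) xs) = underlying D'"
      using map_ends_cong[of "twirl_seg b", OF twirl_seg_ends(1) C(2)] by (simp add: 1 del: map_map)
    ultimately show ?thesis by blast
  qed
next
  assume "turn D D'"
  then show "\<exists>C'. underlying C' = underlying D' \<and> (inflation C C' \<or> slip C C' \<or> slide C C' \<or> twirl C C' \<or> turn C C')"
  proof cases
    case (1 b v vs)
    obtain x xs where C: "C = (b, x # xs)"
      and m: "ends x = ends v"
        "map ends xs = map ends vs"
      using assms(2) 1 by (cases C) (auto simp: map_eq_Cons_conv)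
    have "turn C (b, xs @ [x])"
      unfolding C by (rule turn.intros)
    moreover have "underlying (b, xs @ [x]) = underlying D'"
      using m by (simp add: 1)
    ultimately show ?thesis by blast
  qed
qed

text \<open>Backwards, the old labels must be recovered from the new ones. This is solving linear
  equations, except for a deflation, whose segment has to carry 0; there the balance of C is
  used.\<close>

lemma carry_backward:
  assumes "basic_move D' D" "underlying C = underlying D" "flow C"
  shows "\<exists>C'. underlying C' = underlying D' \<and> basic_move C' C"
  using assms(1) unfolding basic_move_def
proof (elim disjE)
  assume "inflation D' D"
  then show "\<exists>C'. underlying C' = underlying D' \<and> (inflation C' C \<or> slip C' C \<or> slide C' C \<or> twirl C' C \<or> turn C' C)"
  proof cases
    case (1 p b q us ws)
    let ?x = "min p (lift_line p q)" and ?y = "max p (lift_line p q)"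
    obtain us' vs' ws' where C: "C = (b + 1, us' @ vs' @ ws')"
      and m: "map ends us' = map ends (map (lift_seg p) us)"
        "map ends vs' = map ends [(?x, ?y, 0)]"
        "map ends ws' = map ends (map (lift_seg p) ws)"
      using assms(2) unfolding 1 by (rule underlying_append)
    obtain e where vs': "vs' = [(?x, ?y, e)]"
      using m(2) by (auto simp: map_eq_Cons_conv)
    obtain us'' where us'': "map ends us'' = map ends us"
      "us' = map (lift_seg p) us''"
      using map_ends_preimage[of "lift_seg p", OF lift_seg_ends m(1)] by blast
    obtain ws'' where ws'': "map ends ws'' = map ends ws"
      "ws' = map (lift_seg p) ws''"
      using map_ends_preimage[of "lift_seg p", OF lift_seg_ends m(3)] by blast
    \<comment> \<open>The line p meets just the segment to be removed, so balance at p gives label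
      0.\<close>
    have "(\<Sum>v \<leftarrow> snd C. inflow p v) = 0"
      using flow_line[OF assms(3), of p] 1(3,4) by (simp add: C)
    then have "e = 0"
      by (auto simp: C us''(2) ws''(2) vs' min_def max_def o_def split: if_splits)
    then have "inflation (b, us'' @ ws'') C"
      using inflation.intros[OF 1(3-6), of us'' ws''] by (simp add: C us''(2) ws''(2) vs')
    moreover have "underlying (b, us'' @ ws'') = underlying D'"
      using us''(1) ws''(1) by (simp add: 1)
    ultimately show ?thesis by blast
  qed
next
  assume "slip D' D"
  then show "\<exists>C'. underlying C' = underlying D' \<and> (inflation C' C \<or> slip C' C \<or> slide C' C \<or> twirl C' C \<or> turn C' C)"
  proof cases
    case (1 i j k l b us e f ws)
    obtain us' vs' ws' where C: "C = (b, us' @ vs' @ ws')"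
      and m: "map ends us' = map ends us"
        "map ends vs' = map ends [(k, l, f), (i, j, e)]"
        "map ends ws' = map ends ws"
      using assms(2) unfolding 1 by (rule underlying_append)
    obtain f' e' where "vs' = [(k, l, f'), (i, j, e')]"
      using m(2) by (rule map_ends_pair)
    then have "slip (b, us' @ [(i, j, e'), (k, l, f')] @ ws') C"
      using slip.intros[OF 1(3,4), of b us' e' f' ws'] C by simp
    moreover have "underlying (b, us' @ [(i, j, e'), (k, l, f')] @ ws') = underlying D'"
      using m by (simp add: 1)
    ultimately show ?thesis by blast
  qed
next
  assume "slide D' D"
  then show "\<exists>C'. underlying C' = underlying D' \<and> (inflation C' C \<or> slip C' C \<or> slide C' C \<or> twirl C' C \<or> turn C' C)"
  proof cases
    case (1 i j k b us e f ws)
    obtain us' vs' ws' where C: "C = (b, us' @ vs' @ ws')"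
      and m: "map ends us' = map ends us"
        "map ends vs' = map ends [(i, k, f), (i, j, e - f)]"
        "map ends ws' = map ends ws"
      using assms(2) unfolding 1 by (rule underlying_append)
    obtain x y where "vs' = [(i, k, x), (i, j, y)]"
      using m(2) by (rule map_ends_pair)
    \<comment> \<open>The new labels f = x and e - f = y are solved for the old ones.\<close>
    then have "slide (b, us' @ [(i, j, x + y), (j, k, x)] @ ws') C"
      using slide.intros(1)[OF 1(3,4), of b us' "x + y" x ws'] C by simp
    moreover have "underlying (b, us' @ [(i, j, x + y), (j, k, x)] @ ws') = underlying D'"
      using m by (simp add: 1)
    ultimately show ?thesis by blast
  next
    case (2 i j k b us e f ws)
    obtain us' vs' ws' where C: "C = (b, us' @ vs' @ ws')"
      and m: "map ends us' = map ends us"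
        "map ends vs' = map ends [(j, k, f - e), (i, k, e)]"
        "map ends ws' = map ends ws"
      using assms(2) unfolding 2 by (rule underlying_append)
    obtain x y where "vs' = [(j, k, x), (i, k, y)]"
      using m(2) by (rule map_ends_pair)
    then have "slide (b, us' @ [(i, j, y), (j, k, x + y)] @ ws') C"
      using slide.intros(2)[OF 2(3,4), of b us' y "x + y" ws'] C by simp
    moreover have "underlying (b, us' @ [(i, j, y), (j, k, x + y)] @ ws') = underlying D'"
      using m by (simp add: 2)
    ultimately show ?thesis by blast
  qed
next
  assume "twirl D' D"
  then show "\<exists>C'. underlying C' = underlying D' \<and> (inflation C' C \<or> slip C' C \<or> slide C' C \<or> twirl C' C \<or> turn C' C)"
  proof cases
    case (1 b vs)
    obtain xs where C: "C = (b, xs)"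
      "map ends xs = map ends (map (twirl_seg b) vs)"
      using assms(2) 1 by (cases C) auto
    obtain ys where ys: "map ends ys = map ends vs"
      "xs = map (twirl_seg b) ys"
      using map_ends_preimage[of "twirl_seg b", OF twirl_seg_ends C(2)] by blast
    have "twirl (b, ys) C"
      unfolding C ys by (rule twirl.intros)
    moreover have "underlying (b, ys) = underlying D'"
      using ys by (simp add: 1)
    ultimately show ?thesis by blast
  qed
next
  assume "turn D' D"
  then show "\<exists>C'. underlying C' = underlying D' \<and> (inflation C' C \<or> slip C' C \<or> slide C' C \<or> twirl C' C \<or> turn C' C)"
  proof cases
    case (1 b v vs)
    obtain us' vs' ws' where C: "C = (b, us' @ vs' @ ws')"
      and m: "map ends us' = map ends vs"
        "map ends vs' = map ends [v]"
        "map ends ws' = map ends []"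
      using underlying_append[of C b vs "[v]" "[]"] assms(2) 1 by auto
    obtain x where x: "vs' = [x]" "ends x = ends v"
      using m(2) by (auto simp: map_eq_Cons_conv)
    have "turn (b, x # us') C"
      using turn.intros[of b x us'] m(3) by (simp add: C x)
    moreover have "underlying (b, x # us') = underlying D'"
      using m x by (simp add: 1)
    ultimately show ?thesis by blast
  qed
qed

lemma labelled_move_sym: "labelled_move D D' \<Longrightarrow> labelled_move D' D"
  by (auto simp: labelled_move_def)

lemma carry_labels:
  assumes "labelled_move D D'" "underlying C = underlying D" "flow C"
  obtains C' where "underlying C' = underlying D'" "labelled_move C C'"
  using assms carry_forward[of D D' C] carry_backward[of D' D C] unfolding labelled_move_def by metis

text \<open>\<open>same_invariants\<close> may be available only with D' on the left, so balance and
  cyclicity are established for both diagrams, as consequences of their orientations.\<close>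

lemma labelled_move_oriented:
  assumes "labelled_move D D'" "tight (underlying D)" "oriented D"
  shows "tight (underlying D')" "oriented D'" "linking (snd D') = linking (snd D)"
    "rotation D' = rotation D"
proof -
  have inv: "same_invariants D D' \<or> same_invariants D' D"
    using assms(1) basic_move_invariants unfolding labelled_move_def by blast
  then show tight: "tight (underlying D')"
    using assms(2) by (auto simp: same_invariants_def)
  show or: "oriented D'"
    using inv assms(2,3) tight by (auto simp: same_invariants_def oriented_iff_primitive_flow)
  have "flow D" "flow D'" "cyclic D" "cyclic D'"
    using assms(2,3) tight or oriented_iff_primitive_flow reduced_front(1) by blast+
  then show "linking (snd D') = linking (snd D)" "rotation D' = rotation D"
    using inv by (auto simp: same_invariants_def)
qed

text \<open>The orientation chosen in \<open>fence_tb\<close> is D or its reverse, and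
  \<open>linking\<close>, being quadratic in the labels, does not see the sign.\<close>

lemma fence_tb_eq_linking:
  assumes "tight F" "underlying D = F" "oriented D"
  shows "fence_tb F = linking (snd D)"
proof -
  define C where "C = (SOME D. underlying D = F \<and> oriented D)"
  have C: "underlying C = F" "oriented C"
    using someI[of "\<lambda>D. underlying D = F \<and> oriented D" D] assms unfolding C_def by auto
  then have "fence_tb F = linking (snd C)"
    using reduced_front(2)[of C] assms(1) by (simp add: fence_tb_def C_def)
  moreover have "C = D \<or> C = reverse D"
    using oriented_unique[of D C] assms C by simp
  ultimately show ?thesis
    using linking_reverse[of D] by metis
qed

lemma fence_move_oriented:
  assumes "tight F" "fence_move F F'" "underlying D = F" "oriented D"
  shows "\<exists>D'. underlying D' = F' \<and> oriented D' \<and> linking (snd D') = linking (snd D)"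
proof -
  obtain B B' where B: "underlying B = F" "underlying B' = F'" "labelled_move B B'"
    using assms(2) unfolding fence_move_def by blast
  have "flow D"
    using assms oriented_iff_primitive_flow by blast
  then obtain D' where D': "underlying D' = F'" "labelled_move D D'"
    using carry_labels[OF B(3), of D] B assms(3) by metis
  with labelled_move_oriented[OF D'(2) _ assms(4)] assms(1,3) show ?thesis
    by blast
qed

lemma tight_move:
  assumes "tight F" "fence_move F F'"
  shows "tight F'"
proof -
  obtain B B' where B: "underlying B = F" "underlying B' = F'" "labelled_move B B'"
    using assms(2) unfolding fence_move_def by blast
  then have "same_invariants B B' \<or> same_invariants B' B"
    using basic_move_invariants unfolding labelled_move_def by blast
  then show ?thesis
    using B assms(1) by (auto simp: same_invariants_def)
qed

lemma fence_tb_move: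
  assumes "tight F" "fence_move F F'"
  shows "fence_tb F' = fence_tb F"
proof (cases "\<exists>D. underlying D = F \<and> oriented D")
  case True
  then obtain D where D: "underlying D = F" "oriented D" by blast
  then show ?thesis
    using fence_move_oriented[OF assms D] fence_tb_eq_linking assms(1) tight_move[OF assms] by metis
next
  case False
  have "fence_move F' F"
    using assms(2) labelled_move_sym unfolding fence_move_def by blast
  then have "\<nexists>D. underlying D = F' \<and> oriented D"
    using False fence_move_oriented tight_move[OF assms] by blast
  \<comment> \<open>Without orientations both predicates are identically false, so the choice
    operator returns the same default diagram on both sides.\<close>
  with False have "(\<lambda>D. underlying D = F' \<and> oriented D) = (\<lambda>D. underlying D = F \<and> oriented D)"
    by blast
  then show ?thesis
    by (simp only: fence_tb_def)
qed

theorem theorem6p3: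
  fixes F F' :: fence
  assumes "annulus_fence F" and "fence_move F F'"
  shows "fence_tb F' = fence_tb F \<and>
         (\<forall>D D'. underlying D = F \<and> underlying D' = F' \<and> oriented D \<and> labelled_move D D' \<longrightarrow>
            oriented D' \<and> fence_rot D' = fence_rot D) \<and>
         (\<forall>D. underlying D = F \<and> oriented D \<longrightarrow>
            oriented (reverse D) \<and> fence_rot (reverse D) = - fence_rot D)"
proof (intro conjI allI impI; (elim conjE)?)
  have tight: "tight F"
    using assms(1) annulus_fence_linked[OF assms(1)] by (simp add: tight_def annulus_fence_def)
  show "fence_tb F' = fence_tb F"
    using tight assms(2) by (rule fence_tb_move)
  fix D assume D: "underlying D = F" "oriented D"
  then have tightD: "tight (underlying D)"
    using tight by simp
  from underlying_reverse[of D] oriented_reverse[OF tightD D(2)] show "oriented (reverse D)" "fence_rot (reverse D) = - fence_rot D"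
    using reduced_front(3)[of D] reduced_front(3)[of "reverse D"] tightD D(2) by simp_all
  fix D' assume move: "labelled_move D D'"
  note or = labelled_move_oriented[OF move tightD D(2)]
  then show "oriented D'" "fence_rot D' = fence_rot D"
    using reduced_front(3)[OF tightD D(2)] reduced_front(3)[OF or(1,2)] by simp_all
qed

end
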